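(* Let $A$ be a finite abelian group that is not isomorphic to the cyclic group $C_4$ of order $4$. Then the lattice $\mathbb{L}(A)$ is eutactic in its real span $\operatorname{span}_{\mathbb{R}}(\mathbb{L}(A))$.
   Context: Let $A$ be a finite abelian group, written multiplicatively, with group rings $\mathbb{Z}A\subset\mathbb{R}A$. Regard $\mathbb{R}A$ as a Euclidean space with $\langle \sum_a x_a a,\sum_a y_a a\rangle=\sum_a x_a y_a$ and $\|x\|=\sqrt{\langle x,x\rangle}$. Let $\Delta A=\{\sum_a r_a a\in\mathbb{Z}A : \sum_a r_a=0\}$ be the augmentation ideal, let $\psi_A\colon\mathbb{Z}A\to A$ be the homomorphism $\psi_A(\sum_a k_a a)=\prod_a a^{k_a}$ (from the additive group of $\mathbb{Z}A$ to $A$), and let $\mathbb{L}(A)=\operatorname{Ker}(\psi_A)\cap\Delta A$. For a Euclidean space $(V,\langle\cdot,\cdot\rangle)$ and $s\in V$, let $\pi_s\colon V\to V$ be $v\mapsto\langle v,s\rangle s$. A finite subset $S\subset V$ is eutactic in $V$ if there are real numbers $r_s>0$ ($s\in S$) with $\operatorname{Id}_V=\sum_{s\in S}r_s\pi_s$. For a lattice $\Lambda\subset V$, $\operatorname{MinDist}(\Lambda)=\min\{\|x\| : x\in\Lambda, x\neq 0\}$ and $\operatorname{MinVecs}(\Lambda)=\{s\in\Lambda : \|s\|=\operatorname{MinDist}(\Lambda)\}$. The lattice $\Lambda$ is eutactic in $V$ if $\operatorname{MinVecs}(\Lambda)$ is eutactic in $V$. For the zero lattice (the case of trivial $A$) use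 the convention $\operatorname{MinVecs}(0)=\emptyset$. *)

theory Defs
  imports "HOL-Analysis.Analysis" "HOL-Algebra.FiniteProduct" "HOL-Algebra.Elementary_Groups"
begin

text \<open>The carrier of the group is an arbitrary subset of a finite type \<open>'a\<close>. The real group ring
  is realised inside the Euclidean space \<^typ>\<open>real ^ 'a\<close> (standard inner product and norm), and the
  integral group ring inside \<^typ>\<open>int ^ 'a\<close>; coordinates outside the carrier are required to
  vanish.\<close>

definition int_group_ring :: "('a::finite, 'm) monoid_scheme \<Rightarrow> (int ^ 'a) set"
  where "int_group_ring A = {k. \<forall>a. a \<notin> carrier A \<longrightarrow> k $ a = 0}"

definition augmentation_ideal :: "('a::finite, 'm) monoid_scheme \<Rightarrow> (int ^ 'a) set"
  where "augmentation_ideal A = {k \<in> int_group_ring A. (\<Sum>a\<in>carrier A. k $ a) = 0}"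

definition psi :: "('a::finite, 'm) monoid_scheme \<Rightarrow> int ^ 'a \<Rightarrow> 'a"
  where "psi A k = finprod A (\<lambda>a. a [^]\<^bsub>A\<^esub> (k $ a)) (carrier A)"

definition psi_kernel :: "('a::finite, 'm) monoid_scheme \<Rightarrow> (int ^ 'a) set"
  where "psi_kernel A = {k \<in> int_group_ring A. psi A k = \<one>\<^bsub>A\<^esub>}"

definition real_coeffs :: "int ^ 'a \<Rightarrow> real ^ 'a"
  where "real_coeffs k = (\<chi> a. real_of_int (k $ a))"

definition group_lattice :: "('a::finite, 'm) monoid_scheme \<Rightarrow> (real ^ 'a) set"
  where "group_lattice A = real_coeffs ` (psi_kernel A \<inter> augmentation_ideal A)"

definition proj_along :: "'v::real_inner \<Rightarrow> 'v \<Rightarrow> 'v"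
  where "proj_along s v = (v \<bullet> s) *\<^sub>R s"

text \<open>Here \<open>V\<close> is meant to be a finite-dimensional linear subspace, with the restricted inner
  product.\<close>

definition eutactic_in :: "'v::real_inner set \<Rightarrow> 'v set \<Rightarrow> bool"
  where "eutactic_in V S \<longleftrightarrow>
    finite S \<and> S \<subseteq> V \<and>
    (\<exists>r :: 'v \<Rightarrow> real. (\<forall>s\<in>S. r s > 0) \<and>
       (\<forall>v\<in>V. v = (\<Sum>s\<in>S. r s *\<^sub>R proj_along s v)))"

text \<open>The minimum exists for every nonzero lattice; for the zero lattice \<open>min_dist\<close> is unspecified,
  and \<open>min_vecs\<close> is empty by convention.\<close>

definition min_dist :: "'v::real_inner set \<Rightarrow> real"
  where "min_dist L = (LEAST d. d \<in> norm ` (L - {0}))"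

definition min_vecs :: "'v::real_inner set \<Rightarrow> 'v set"
  where "min_vecs L = (if L = {0} then {} else {s \<in> L. norm s = min_dist L})"

definition eutactic_lattice_in :: "'v::real_inner set \<Rightarrow> 'v set \<Rightarrow> bool"
  where "eutactic_lattice_in V L \<longleftrightarrow> eutactic_in V (min_vecs L)"

end

theory Submission
  imports Defs "HOL-Algebra.Multiplicative_Group"
begin

text \<open>If \<open>A\<close> has at least five elements, or four elements of order at most two, the minimal
  vectors of the lattice are the \<open>a + b - c - d\<close> with \<open>a b = c d\<close> and \<open>a\<close>, \<open>b\<close>, \<open>c\<close>, \<open>d\<close> distinct:
  subtracting \<open>a - c\<close> with \<open>a\<close> in the positive and \<open>c\<close> in the negative support lowers the squared
  norm by at least two, and no \<open>a - c\<close> with \<open>a \<noteq> c\<close> lies in the lattice. Let \<open>n\<close> be the order of \<open>A\<close>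
  and \<open>t\<close> the number of solutions of \<open>x\<^sup>2 = 1\<close>. If \<open>t = n\<close>, equal weights work. Otherwise
  the weight
  \<open>1 - (t - |{x. x\<^sup>2 = a b}|) / n - ([a\<^sup>2 = c\<^sup>2] + [a\<^sup>2 = d\<^sup>2]) / (n - 2)\<close> makes the form
  scalar on the sum-zero vectors. It is positive because \<open>t\<close> is a proper divisor of \<open>n\<close> and
  \<open>t \<noteq> 3\<close>. For \<open>n = 2\<close> and \<open>n = 3\<close> the minimal vectors are the multiples
  \<open>\<plusminus>c (n a - \<Sum>x. x)\<close> with \<open>c = 2\<close> and \<open>c = 1\<close>, respectively.\<close>

subsection \<open>Sums over relations \<open>x b = c d\<close>\<close>

context comm_group
begin

definition square_roots :: "'a \<Rightarrow> 'a set"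
  where "square_roots g = {x \<in> carrier G. x \<otimes> x = g}"

lemma divide_eq_iff:
  assumes "a \<in> carrier G" "b \<in> carrier G" "c \<in> carrier G"
  shows "c = a \<otimes> b \<otimes> inv c \<longleftrightarrow> b = c \<otimes> c \<otimes> inv a"
  using assms by (metis inv_closed inv_solve_right m_closed m_comm)

lemma sum_divide_left:
  fixes v :: "'a \<Rightarrow> 'c::comm_monoid_add"
  assumes "a \<in> carrier G"
  shows "(\<Sum>c\<in>carrier G. v (a \<otimes> inv c)) = (\<Sum>c\<in>carrier G. v c)"
  by (rule sum.reindex_bij_witness[where i = "\<lambda>c. a \<otimes> inv c" and j = "\<lambda>c. a \<otimes> inv c"])
    (use assms in \<open>auto simp: inv_mult_group m_assoc[symmetric] m_comm[of a]\<close>;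
     metis inv_closed inv_solve_right m_closed m_comm inv_inv)+

lemma sum_mult_left:
  fixes v :: "'a \<Rightarrow> 'c::comm_monoid_add"
  assumes "a \<in> carrier G"
  shows "(\<Sum>b\<in>carrier G. v (a \<otimes> b)) = (\<Sum>b\<in>carrier G. v b)"
  by (rule sum.reindex_bij_witness[where i = "\<lambda>b. inv a \<otimes> b" and j = "\<lambda>b. a \<otimes> b"])
    (use assms in \<open>auto simp: m_assoc[symmetric]\<close>)

lemma square_eq_iff:
  assumes "x \<in> carrier G" "y \<in> carrier G"
  shows "x \<otimes> x = y \<otimes> y \<longleftrightarrow> (x \<otimes> inv y) \<otimes> (x \<otimes> inv y) = \<one>"
proof -
  have "(x \<otimes> inv y) \<otimes> (x \<otimes> inv y) = (x \<otimes> x) \<otimes> inv (y \<otimes> y)"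
    using assms by (simp add: inv_mult_group m_ac)
  thus ?thesis
    using assms by (metis inv_closed inv_equality inv_inv m_closed r_inv inv_comm)
qed

text \<open>The roots of a square form a coset of the subgroup of roots of one, and translation by
  \<open>x\<close> is the bijection. So an element has either no root or as many roots as
  one.\<close>

lemma card_square_roots_square:
  assumes "x \<in> carrier G"
  shows "card (square_roots (x \<otimes> x)) = card (square_roots \<one>)"
proof (rule bij_betw_same_card)
  have mult: "(y \<otimes> x) \<otimes> (y \<otimes> x) = (y \<otimes> y) \<otimes> (x \<otimes> x)" if "y \<in> carrier G" for y
    using that assms by (simp add: m_ac)
  have cancel: "y \<otimes> inv x \<otimes> x = y" "y \<otimes> x \<otimes> inv x = y" if "y \<in> carrier G" for y
    using that assms by (simp_all add: m_assoc)
  show "bij_betw (\<lambda>y. y \<otimes> inv x) (square_roots (x \<otimes> x)) (square_roots \<one>)"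
    by (rule bij_betw_byWitness[where f' = "\<lambda>y. y \<otimes> x"])
      (use assms in \<open>auto simp: square_roots_def mult cancel square_eq_iff\<close>)
qed

text \<open>Double counting of the pairs \<open>(b, y)\<close> with
  \<open>y \<otimes> y = x \<otimes> b\<close>, in which \<open>y\<close> determines
  \<open>b\<close>.\<close>

lemma sum_card_square_roots:
  fixes f :: "'a \<Rightarrow> real"
  assumes fin: "finite (carrier G)" and x: "x \<in> carrier G"
  shows "(\<Sum>b\<in>carrier G. real (card (square_roots (x \<otimes> b))) * f b)
       = (\<Sum>y\<in>carrier G. f (y \<otimes> y \<otimes> inv x))"
proof -
  have "real (card (square_roots (x \<otimes> b))) * f b
      = (\<Sum>y\<in>carrier G. if b = y \<otimes> y \<otimes> inv x then f b else 0)" if "b \<in> carrier G" for b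
  proof -
    have "square_roots (x \<otimes> b) = {y \<in> carrier G. b = y \<otimes> y \<otimes> inv x}"
      using x that inv_solve_right[of b "_ \<otimes> _" x] m_comm[of x b] by (auto simp: square_roots_def)
    thus ?thesis
      by (subst sum.inter_filter[OF fin, symmetric], subst sum_constant) simp
  qed
  hence "(\<Sum>b\<in>carrier G. real (card (square_roots (x \<otimes> b))) * f b)
      = (\<Sum>y\<in>carrier G. \<Sum>b\<in>carrier G. if b = y \<otimes> y \<otimes> inv x then f b else 0)"
    by (simp, subst sum.swap, simp)
  also have "\<dots> = (\<Sum>y\<in>carrier G. f (y \<otimes> y \<otimes> inv x))"
    using fin x by (intro sum.cong) auto
  finally show ?thesis .
qed

text \<open>The first entry \<open>x\<close> of a relation \<open>x b = c d\<close> is fixed. The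
  entries \<open>b\<close> and \<open>c\<close> are free and determine the last one,
  \<open>d b c\<close>, and \<open>g b c\<close> is the inner product of \<open>v\<close> with the
  vector of this relation. \<open>K\<close> sums \<open>v\<close> over the coset of \<open>x\<close>
  modulo the roots of one. \<open>U\<close> is \<open>t\<close> times the sum of \<open>v\<close>
  over the coset of \<open>x\<close> modulo the squares, because \<open>x\<close> and its inverse
  differ by a square. These two sums are the obstruction to a scalar form.\<close>

context
  fixes v :: "'a \<Rightarrow> real" and x :: 'a and d :: "'a \<Rightarrow> 'a \<Rightarrow> 'a" and g :: "'a \<Rightarrow> 'a \<Rightarrow> real" and n t K U
  assumes fin: "finite (carrier G)" and x: "x \<in> carrier G"
    and sum0: "(\<Sum>a\<in>carrier G. v a) = 0"
  defines "d \<equiv> (\<lambda>b c. x \<otimes> b \<otimes> inv c)"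
    and "g \<equiv> (\<lambda>b c. v x + v b - v c - v (d b c))"
    and "n \<equiv> real (card (carrier G))" and "t \<equiv> real (card (square_roots \<one>))"
    and "K \<equiv> (\<Sum>c\<in>square_roots (x \<otimes> x). v c)"
    and "U \<equiv> (\<Sum>c\<in>carrier G. v (c \<otimes> c \<otimes> inv x))"
begin

lemma row_sum: "b \<in> carrier G \<Longrightarrow> (\<Sum>c\<in>carrier G. g b c) = n * (v x + v b)"
  using sum_divide_left[of "x \<otimes> b" v] x sum0
  by (simp add: g_def d_def sum.distrib sum_subtractf n_def algebra_simps)

lemma column_sum:
  assumes c: "c \<in> carrier G"
  shows "(\<Sum>b\<in>carrier G. g b c) = n * (v x - v c)"
proof -
  have "(\<Sum>b\<in>carrier G. v (d b c)) = (\<Sum>b\<in>carrier G. v ((x \<otimes> inv c) \<otimes> b))"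
    using x c by (intro sum.cong) (auto simp: d_def m_ac)
  also have "\<dots> = 0"
    using sum_mult_left[of "x \<otimes> inv c" v] x c sum0 by simp
  finally show ?thesis
    using sum0 by (simp add: g_def sum.distrib sum_subtractf n_def algebra_simps)
qed

text \<open>From the full double sum the row \<open>b = x\<close> is dropped first, then the
  remaining entries with \<open>c = d b c\<close>.\<close>

lemma sum_nondegenerate:
  "(\<Sum>b\<in>carrier G. \<Sum>c\<in>carrier G. if b = x \<or> c = d b c then 0 else g b c)
    = (n^2 - 3 * n + 2 * t) * v x - 2 * K - U"
proof -
  \<comment> \<open>For each \<open>c\<close> exactly one \<open>b\<close> gives
    \<open>c = d b c\<close>, namely the square of \<open>c\<close> divided by \<open>x\<close>. It
    lies in the row \<open>b = x\<close>, which is already dropped, exactly when \<open>c\<close> is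
    a root of the square of \<open>x\<close>; this is the correction term.\<close>
  have diag: "(\<Sum>b\<in>carrier G. if b = x \<or> c \<noteq> d b c then 0 else g b c)
      = (v x + v (c \<otimes> c \<otimes> inv x) - 2 * v c) - (if c \<in> square_roots (x \<otimes> x) then 2 * v x - 2 * v c else 0)"
    if c: "c \<in> carrier G" for c
  proof -
    have "(\<Sum>b\<in>carrier G. if b = x \<or> c \<noteq> d b c then 0 else g b c)
      = (\<Sum>b\<in>carrier G. if b = c \<otimes> c \<otimes> inv x then (if b = x then 0 else v x + v b - 2 * v c) else 0)"
      using x c divide_eq_iff[of x _ c, symmetric] by (intro sum.cong) (auto simp: d_def g_def)
    also have "\<dots> = (if c \<otimes> c \<otimes> inv x = x then 0 else v x + v (c \<otimes> c \<otimes> inv x) - 2 * v c)"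
      using x c fin by simp
    also have "c \<otimes> c \<otimes> inv x = x \<longleftrightarrow> c \<in> square_roots (x \<otimes> x)"
      using x c by (auto simp: square_roots_def inv_solve_right')
    moreover have "x \<otimes> x \<otimes> inv x = x"
      using x by (simp add: m_assoc)
    ultimately show ?thesis
      using x c by (auto simp: square_roots_def)
  qed
  have "(\<Sum>b\<in>carrier G. \<Sum>c\<in>carrier G. if b = x \<or> c = d b c then 0 else g b c)
    = (\<Sum>b\<in>carrier G. (if b = x then 0 else \<Sum>c\<in>carrier G. g b c)
        - (\<Sum>c\<in>carrier G. if b = x \<or> c \<noteq> d b c then 0 else g b c))"
    by (intro sum.cong refl) (auto simp: sum_subtractf[symmetric] intro!: sum.cong)
  also have "\<dots> = (\<Sum>b\<in>carrier G. if b = x then 0 else n * (v x + v b))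
      - (\<Sum>c\<in>carrier G. \<Sum>b\<in>carrier G. if b = x \<or> c \<noteq> d b c then 0 else g b c)"
    unfolding sum_subtractf
    by (rule arg_cong2[where f = "(-)"], simp add: row_sum cong: if_cong, rule sum.swap)
  also have "(\<Sum>b\<in>carrier G. if b = x then 0 else n * (v x + v b))
      = (\<Sum>b\<in>carrier G. n * (v x + v b) - (if b = x then 2 * n * v x else 0))"
    by (intro sum.cong) auto
  also have "\<dots> = n^2 * v x - 2 * n * v x"
    using x fin sum0
    by (simp add: sum_subtractf sum.distrib sum_distrib_left[symmetric] n_def power2_eq_square)
  also have "(\<Sum>c\<in>carrier G. \<Sum>b\<in>carrier G. if b = x \<or> c \<noteq> d b c then 0 else g b c)
      = n * v x + U - (\<Sum>c\<in>carrier G. if c \<in> square_roots (x \<otimes> x) then 2 * v x - 2 * v c else 0)"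
    using sum0 by (simp add: diag sum_subtractf sum.distrib sum_distrib_left[symmetric] n_def U_def)
  also have "(\<Sum>c\<in>carrier G. if c \<in> square_roots (x \<otimes> x) then 2 * v x - 2 * v c else 0)
      = (\<Sum>c\<in>square_roots (x \<otimes> x). 2 * v x - 2 * v c)"
    using fin by (auto simp: sum.If_cases square_roots_def intro!: sum.cong)
  also have "\<dots> = 2 * t * v x - 2 * K"
    using card_square_roots_square[OF x]
    by (simp add: sum_subtractf sum_distrib_left[symmetric] K_def t_def)
  finally show ?thesis by (simp add: algebra_simps)
qed

text \<open>By \<open>card_square_roots_square\<close> the factor is \<open>t\<close> when
  \<open>x b\<close> is not a square and 0 otherwise. After \<open>row_sum\<close>,
  \<open>sum_card_square_roots\<close> turns the remaining sum over \<open>b\<close> into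
  \<open>U\<close>.\<close>

lemma sum_nonsquare:
  "(\<Sum>b\<in>carrier G. \<Sum>c\<in>carrier G. (t - card (square_roots (x \<otimes> b))) * g b c)
    = n * ((t * n - n) * v x - U)"
proof -
  have "(\<Sum>b\<in>carrier G. \<Sum>c\<in>carrier G. (t - card (square_roots (x \<otimes> b))) * g b c)
      = (\<Sum>b\<in>carrier G. (t - card (square_roots (x \<otimes> b))) * (n * (v x + v b)))"
    by (simp add: row_sum sum_distrib_left[symmetric])
  also have "\<dots> = (\<Sum>b\<in>carrier G. t * n * v x + t * n * v b)
      - (\<Sum>b\<in>carrier G. card (square_roots (x \<otimes> b)) * (n * (v x + v b)))"
    by (simp add: sum_subtractf[symmetric] algebra_simps)
  also have "(\<Sum>b\<in>carrier G. card (square_roots (x \<otimes> b)) * (n * (v x + v b)))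
     = n * (n * v x + U)"
    unfolding sum_card_square_roots[OF fin x]
    by (simp add: sum.distrib sum_distrib_left[symmetric] U_def n_def)
  also have "(\<Sum>b\<in>carrier G. t * n * v x + t * n * v b) = n * (t * n * v x)"
    using sum0 by (simp add: sum.distrib sum_distrib_left[symmetric] n_def)
  finally show ?thesis by (simp add: algebra_simps)
qed

lemma sum_square_eq_left:
  "(\<Sum>b\<in>carrier G. \<Sum>c\<in>carrier G. if b \<noteq> x \<and> x \<otimes> x = c \<otimes> c then g b c else 0)
    = (n - 2) * (t * v x - K)"
proof -
  have "(\<Sum>b\<in>carrier G. \<Sum>c\<in>carrier G. if b \<noteq> x \<and> x \<otimes> x = c \<otimes> c then g b c else 0)
      = (\<Sum>c\<in>carrier G. if c \<in> square_roots (x \<otimes> x) then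
          (\<Sum>b\<in>carrier G. g b c - (if b = x then g x c else 0)) else 0)"
    by (subst sum.swap) (auto simp: square_roots_def intro!: sum.cong sum.neutral)
  also have "\<dots> = (\<Sum>c\<in>carrier G. if c \<in> square_roots (x \<otimes> x) then (n - 2) * (v x - v c) else 0)"
  proof (intro sum.cong refl if_cong)
    fix c assume "c \<in> square_roots (x \<otimes> x)"
    hence c: "c \<in> carrier G" "x \<otimes> x = c \<otimes> c" by (auto simp: square_roots_def)
    \<comment> \<open>At \<open>b = x\<close> the last entry is \<open>c\<close> again, so this
      entry of the column is \<open>2 * (v x - v c)\<close>. Removing it from
      \<open>n * (v x - v c)\<close> leaves the factor \<open>n - 2\<close>.\<close>
    hence "d x c = c" by (simp add: d_def m_assoc)
    thus "(\<Sum>b\<in>carrier G. g b c - (if b = x then g x c else 0)) = (n - 2) * (v x - v c)"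
      using c fin x by (simp add: sum_subtractf column_sum) (simp add: g_def algebra_simps)
  qed
  also have "\<dots> = (\<Sum>c\<in>square_roots (x \<otimes> x). (n - 2) * (v x - v c))"
    using fin by (auto simp: sum.If_cases square_roots_def intro!: sum.cong)
  finally show ?thesis
    using card_square_roots_square[OF x]
    by (simp add: sum_subtractf sum_distrib_left[symmetric] K_def t_def)
qed

text \<open>Exchanging \<open>c\<close> with \<open>d b c\<close> is an involution that leaves
  \<open>g\<close> unchanged and reduces this to the previous sum.\<close>

lemma sum_square_eq_right:
  "(\<Sum>b\<in>carrier G. \<Sum>c\<in>carrier G. if b \<noteq> x \<and> x \<otimes> x = d b c \<otimes> d b c then g b c else 0)
    = (n - 2) * (t * v x - K)"
proof -
  have "(\<Sum>c\<in>carrier G. if b \<noteq> x \<and> x \<otimes> x = d b c \<otimes> d b c then g b c else 0)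
      = (\<Sum>c\<in>carrier G. if b \<noteq> x \<and> x \<otimes> x = c \<otimes> c then g b c else 0)" (is "_ = sum ?h _")
    if b: "b \<in> carrier G" for b
  proof -
    have dd: "d b (d b c) = c" if "c \<in> carrier G" for c
      using x b that by (simp add: d_def inv_mult_group m_ac)
    have "(\<Sum>c\<in>carrier G. ?h (x \<otimes> b \<otimes> inv c)) = sum ?h (carrier G)"
      using x b by (intro sum_divide_left) auto
    moreover have "?h (x \<otimes> b \<otimes> inv c)
      = (if b \<noteq> x \<and> x \<otimes> x = d b c \<otimes> d b c then g b c else 0)" if "c \<in> carrier G" for c
      using dd[OF that] by (auto simp: g_def d_def)
    ultimately show ?thesis by simp
  qed
  thus ?thesis using sum_square_eq_left by simp
qed

end

end


section \<open>Eutactic sets from weighted sums over quads\<close>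

definition quads :: "('a, 'm) monoid_scheme \<Rightarrow> ('a \<times> 'a \<times> 'a \<times> 'a) set"
  where "quads A = {(a, b, c, d). a \<in> carrier A \<and> b \<in> carrier A \<and> c \<in> carrier A \<and> d \<in> carrier A
    \<and> a \<otimes>\<^bsub>A\<^esub> b = c \<otimes>\<^bsub>A\<^esub> d}"

text \<open>Cancellation in \<open>a b = c d\<close> also separates \<open>b\<close> from
  \<open>c\<close> and \<open>d\<close>, so all four entries are distinct.\<close>

definition proper_quads :: "('a, 'm) monoid_scheme \<Rightarrow> ('a \<times> 'a \<times> 'a \<times> 'a) set"
  where "proper_quads A = {(a, b, c, d) \<in> quads A. a \<noteq> b \<and> c \<noteq> d \<and> a \<noteq> c \<and> a \<noteq> d}"

text \<open>Generic in the ring, so that one expression serves as an integral relation and as a real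
  vector.\<close>

definition quad_vec :: "'a \<times> 'a \<times> 'a \<times> 'a \<Rightarrow> 'r::ring_1 ^ 'a"
  where "quad_vec = (\<lambda>(a, b, c, d). axis a 1 + axis b 1 - axis c 1 - axis d 1)"

text \<open>The map \<open>s\<close> may fail to be injective: permuted quads share their vector.
  The coefficient of a vector is the total weight of its fibre divided by \<open>l\<close>.\<close>

lemma eutactic_inI:
  fixes s :: "'q \<Rightarrow> 'v::real_inner"
  assumes fin: "finite Q" and r: "\<And>q. q \<in> Q \<Longrightarrow> r q > 0" and S: "S = s ` Q" "S \<subseteq> V"
    and "l > 0" and sum: "\<And>v. v \<in> V \<Longrightarrow> (\<Sum>q\<in>Q. r q *\<^sub>R proj_along (s q) v) = l *\<^sub>R v"
  shows "eutactic_in V S"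
  unfolding eutactic_in_def
proof (intro conjI exI ballI)
  let ?r = "\<lambda>y. (\<Sum>q | q \<in> Q \<and> s q = y. r q) / l"
  show "?r y > 0" if "y \<in> S" for y
    using that S fin r \<open>l > 0\<close> by (auto intro!: divide_pos_pos sum_pos)
  show "v = (\<Sum>y\<in>S. ?r y *\<^sub>R proj_along y v)" if "v \<in> V" for v
  proof -
    have "(\<Sum>q\<in>Q. r q *\<^sub>R proj_along (s q) v)
        = (\<Sum>y\<in>S. \<Sum>q | q \<in> Q \<and> s q = y. r q *\<^sub>R proj_along (s q) v)"
      unfolding S by (rule sum.image_gen[OF fin])
    also have "\<dots> = (\<Sum>y\<in>S. (l * ?r y) *\<^sub>R proj_along y v)"
      using \<open>l > 0\<close> by (intro sum.cong refl) (simp add: scaleR_left.sum)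
    also have "\<dots> = l *\<^sub>R (\<Sum>y\<in>S. ?r y *\<^sub>R proj_along y v)"
      by (simp only: scaleR_right.sum scaleR_scaleR)
    finally show ?thesis
      using \<open>l > 0\<close> by (simp only: sum[OF that] scaleR_cancel_left) simp
  qed
qed (use S fin in auto)

text \<open>A quad with first entry \<open>x\<close> is parametrised by its second and third
  entries, which range freely.\<close>

lemma sum_quads_first:
  fixes A :: "('a::finite, 'm) monoid_scheme" and f :: "_ \<Rightarrow> real"
  assumes "comm_group A"
  shows "(\<Sum>q\<in>quads A. f q * axis (fst q) 1 $ x) =
    (if x \<in> carrier A
     then \<Sum>b\<in>carrier A. \<Sum>c\<in>carrier A. f (x, b, c, x \<otimes>\<^bsub>A\<^esub> b \<otimes>\<^bsub>A\<^esub> inv\<^bsub>A\<^esub> c) else 0)"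
proof -
  interpret comm_group A by fact
  have "(\<Sum>q\<in>quads A. f q * axis (fst q) 1 $ x) = (\<Sum>q\<in>{q \<in> quads A. fst q = x}. f q)"
    by (subst sum.inter_filter) (auto simp: axis_def intro!: sum.cong)
  also have "\<dots> = (if x \<in> carrier A then \<Sum>(b, c)\<in>carrier A \<times> carrier A. f (x, b, c, x \<otimes>\<^bsub>A\<^esub> b \<otimes>\<^bsub>A\<^esub> inv\<^bsub>A\<^esub> c) else 0)"
  proof (cases "x \<in> carrier A")
    case True
    have "c \<otimes>\<^bsub>A\<^esub> d \<otimes>\<^bsub>A\<^esub> inv\<^bsub>A\<^esub> c = d" "c \<otimes>\<^bsub>A\<^esub> (d \<otimes>\<^bsub>A\<^esub> inv\<^bsub>A\<^esub> c) = d"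
      if "c \<in> carrier A" "d \<in> carrier A" for c d
      using that by (simp_all add: m_comm[of c] m_assoc[symmetric]) (simp_all add: m_assoc)
    with True show ?thesis
      by (simp, intro sum.reindex_bij_witness[where j = "\<lambda>(a, b, c, d). (b, c)"
          and i = "\<lambda>(b, c). (x, b, c, x \<otimes>\<^bsub>A\<^esub> b \<otimes>\<^bsub>A\<^esub> inv\<^bsub>A\<^esub> c)"]) (auto simp: quads_def)
  qed (auto simp: quads_def intro!: sum.neutral)
  finally show ?thesis by (simp add: sum.cartesian_product)
qed

text \<open>Swapping \<open>a\<close> with \<open>b\<close> preserves the coefficient
  \<open>f\<close> of a quad vector, while exchanging the two pairs negates it, just as it negates
  the vector. Hence all four entries contribute equally to a coordinate, and only the quads with
  first entry \<open>x\<close> have to be summed. This is the factor 4.\<close>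

lemma quad_sum_eq:
  fixes A :: "('a::finite, 'm) monoid_scheme" and v :: "real ^ 'a"
  assumes "comm_group A"
    and W: "\<And>a b c d. (a, b, c, d) \<in> quads A \<Longrightarrow> W (b, a, c, d) = W (a, b, c, d) \<and> W (c, d, a, b) = W (a, b, c, d)"
    and supp: "\<And>x. x \<notin> carrier A \<Longrightarrow> v $ x = 0"
    and sum: "\<And>x. x \<in> carrier A \<Longrightarrow> (\<Sum>b\<in>carrier A. \<Sum>c\<in>carrier A.
        W (x, b, c, x \<otimes>\<^bsub>A\<^esub> b \<otimes>\<^bsub>A\<^esub> inv\<^bsub>A\<^esub> c) * (v $ x + v $ b - v $ c - v $ (x \<otimes>\<^bsub>A\<^esub> b \<otimes>\<^bsub>A\<^esub> inv\<^bsub>A\<^esub> c))) = l * v $ x"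
  shows "(\<Sum>q\<in>quads A. W q *\<^sub>R proj_along (quad_vec q) v) = (4 * l) *\<^sub>R v"
proof -
  interpret comm_group A by fact
  define f where "f q = W q * (v \<bullet> quad_vec q)" for q
  have fq: "f (a, b, c, d) = W (a, b, c, d) * (v $ a + v $ b - v $ c - v $ d)" for a b c d
    by (simp add: f_def quad_vec_def inner_add_right inner_diff_right inner_axis)
  have swap: "(b, a, c, d) \<in> quads A \<longleftrightarrow> (a, b, c, d) \<in> quads A"
    "(c, d, a, b) \<in> quads A \<longleftrightarrow> (a, b, c, d) \<in> quads A" for a b c d
    by (auto simp: quads_def m_comm)
  have f1: "f (b, a, c, d) = f (a, b, c, d) \<and> f (c, d, a, b) = - f (a, b, c, d)"
    if "(a, b, c, d) \<in> quads A" for a b c d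
    using W[OF that] by (auto simp: fq algebra_simps)
  have f2: "f (d, c, a, b) = - f (a, b, c, d)" if "(a, b, c, d) \<in> quads A" for a b c d
    using f1[of a b c d] f1[of c d a b] that swap(2)[of a b c d] by auto
  have coord: "(\<Sum>q\<in>quads A. f q * quad_vec q $ x) = 4 * (\<Sum>q\<in>quads A. f q * axis (fst q) 1 $ x)" for x
  proof -
    let ?e = "\<lambda>a::'a. axis a (1::real) $ x"
    have 2: "(\<Sum>(a, b, c, d)\<in>quads A. f (a, b, c, d) * ?e b) = (\<Sum>(a, b, c, d)\<in>quads A. f (a, b, c, d) * ?e a)"
      by (rule sum.reindex_bij_witness[where j = "\<lambda>(a, b, c, d). (b, a, c, d)" and i = "\<lambda>(a, b, c, d). (b, a, c, d)"])
        (auto simp: swap dest: f1)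
    have 3: "(\<Sum>(a, b, c, d)\<in>quads A. f (a, b, c, d) * ?e c) = (\<Sum>(a, b, c, d)\<in>quads A. - f (a, b, c, d) * ?e a)"
      by (rule sum.reindex_bij_witness[where j = "\<lambda>(a, b, c, d). (c, d, a, b)" and i = "\<lambda>(a, b, c, d). (c, d, a, b)"])
        (auto simp: swap dest: f1)
    \<comment> \<open>This rearrangement has order four, so its inverse is a different map.\<close>
    have 4: "(\<Sum>(a, b, c, d)\<in>quads A. f (a, b, c, d) * ?e d) = (\<Sum>(a, b, c, d)\<in>quads A. - f (a, b, c, d) * ?e a)"
      by (rule sum.reindex_bij_witness[where j = "\<lambda>(a, b, c, d). (d, c, a, b)" and i = "\<lambda>(a, b, c, d). (c, d, b, a)"])
        (auto simp: swap dest: f2)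
    have "(\<Sum>q\<in>quads A. f q * quad_vec q $ x) = (\<Sum>(a, b, c, d)\<in>quads A. f (a, b, c, d) * ?e a)
      + (\<Sum>(a, b, c, d)\<in>quads A. f (a, b, c, d) * ?e b) - (\<Sum>(a, b, c, d)\<in>quads A. f (a, b, c, d) * ?e c)
      - (\<Sum>(a, b, c, d)\<in>quads A. f (a, b, c, d) * ?e d)"
      unfolding sum.distrib[symmetric] sum_subtractf[symmetric]
      by (intro sum.cong) (auto simp: quad_vec_def algebra_simps)
    also have "\<dots> = 4 * (\<Sum>(a, b, c, d)\<in>quads A. f (a, b, c, d) * ?e a)"
      unfolding 2 3 4 by (simp add: sum_negf case_prod_unfold)
    finally show ?thesis by (simp add: case_prod_unfold)
  qed
  show ?thesis
  proof (rule vec_eq_iff[THEN iffD2, rule_format])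
    fix x
    have "(\<Sum>q\<in>quads A. W q *\<^sub>R proj_along (quad_vec q) v) $ x = (\<Sum>q\<in>quads A. f q * quad_vec q $ x)"
      by (simp add: proj_along_def f_def mult.assoc)
    also have "\<dots> = 4 * (if x \<in> carrier A then l * v $ x else 0)"
      unfolding coord sum_quads_first[OF assms(1)] using sum[of x] by (simp add: fq)
    finally show "(\<Sum>q\<in>quads A. W q *\<^sub>R proj_along (quad_vec q) v) $ x = ((4 * l) *\<^sub>R v) $ x"
      using supp[of x] by simp
  qed
qed

text \<open>For constant weight \<open>1\<close>, the quadratic form of the minimal vectors differs from a scalar
  by the projections onto the functions invariant under the elements of order two and under the
  squares, respectively. The \<open>\<beta>\<close>-term lowers the weight where \<open>a / c\<close> or \<open>a / d\<close> has order at most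
  two and cancels the first projection; the \<open>\<alpha>\<close>-term lowers it where \<open>a b\<close> is not a square and
  cancels the second. Setting the weight to \<open>0\<close> when \<open>a = b\<close> or \<open>c = d\<close> discards the vectors
  with a coefficient \<open>2\<close>; the quads with \<open>a = c\<close> or \<open>a = d\<close> give the zero vector and do no harm.\<close>

definition quad_weight :: "('a, 'm) monoid_scheme \<Rightarrow> real \<Rightarrow> real \<Rightarrow> 'a \<times> 'a \<times> 'a \<times> 'a \<Rightarrow> real"
  where "quad_weight A \<alpha> \<beta> = (\<lambda>(a, b, c, d). if a = b \<or> c = d then 0 else
    1 - \<alpha> * (real (card (comm_group.square_roots A \<one>\<^bsub>A\<^esub>)) - real (card (comm_group.square_roots A (a \<otimes>\<^bsub>A\<^esub> b))))
      - \<beta> * (of_bool (a \<otimes>\<^bsub>A\<^esub> a = c \<otimes>\<^bsub>A\<^esub> c) + of_bool (a \<otimes>\<^bsub>A\<^esub> a = d \<otimes>\<^bsub>A\<^esub> d)))"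

section \<open>Symmetry, sums and positivity of the weight\<close>

context comm_group
begin

lemma mult_eq_mult_cancel:
  assumes "p \<otimes> q = r \<otimes> s" "p \<in> carrier G" "q \<in> carrier G" "r \<in> carrier G" "s \<in> carrier G"
  shows "q = r \<longleftrightarrow> p = s"
  using assms m_comm[of r s] right_cancel[of q p s] right_cancel[of s q r] m_comm[of s q] by auto

text \<open>The squares of the entries again form a relation, so cancellation carries a coincidence
  of two squares over to the other two. This makes the \<beta>-term of the weight symmetric.\<close>

lemma quad_squares:
  assumes "(a, b, c, d) \<in> quads G"
  shows "b \<otimes> b = c \<otimes> c \<longleftrightarrow> a \<otimes> a = d \<otimes> d" "b \<otimes> b = d \<otimes> d \<longleftrightarrow> a \<otimes> a = c \<otimes> c"
proof -
  have carr: "a \<in> carrier G" "b \<in> carrier G" "c \<in> carrier G" "d \<in> carrier G"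
    and ab: "a \<otimes> b = c \<otimes> d" using assms by (auto simp: quads_def)
  have "(a \<otimes> a) \<otimes> (b \<otimes> b) = (a \<otimes> b) \<otimes> (a \<otimes> b)"
    using carr by (simp add: m_ac)
  also have "\<dots> = (c \<otimes> c) \<otimes> (d \<otimes> d)"
    unfolding ab using carr by (simp add: m_ac)
  finally have eq: "(a \<otimes> a) \<otimes> (b \<otimes> b) = (c \<otimes> c) \<otimes> (d \<otimes> d)" .
  show "b \<otimes> b = c \<otimes> c \<longleftrightarrow> a \<otimes> a = d \<otimes> d"
    by (rule mult_eq_mult_cancel[OF eq]) (use carr in auto)
  show "b \<otimes> b = d \<otimes> d \<longleftrightarrow> a \<otimes> a = c \<otimes> c"
    by (rule mult_eq_mult_cancel) (use carr eq m_comm[of "c \<otimes> c" "d \<otimes> d"] in auto)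
qed

lemma quad_weight_sym:
  assumes q: "(a, b, c, d) \<in> quads G"
  shows "quad_weight G \<alpha> \<beta> (b, a, c, d) = quad_weight G \<alpha> \<beta> (a, b, c, d)
    \<and> quad_weight G \<alpha> \<beta> (c, d, a, b) = quad_weight G \<alpha> \<beta> (a, b, c, d)"
proof -
  have carr: "a \<otimes> b = c \<otimes> d" "b \<otimes> a = c \<otimes> d" using q m_comm[of a b] by (auto simp: quads_def)
  note sq = quad_squares[OF q]
  have "c \<otimes> c = b \<otimes> b \<longleftrightarrow> a \<otimes> a = d \<otimes> d" "c \<otimes> c = a \<otimes> a \<longleftrightarrow> a \<otimes> a = c \<otimes> c" using sq by auto
  thus ?thesis
    by (auto simp: quad_weight_def carr sq)
qed

text \<open>The weight splits into the kinds of sums computed above. The result is an explicit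
  combination of \<open>v x\<close>, \<open>K\<close> and \<open>U\<close>, from which the
  coefficients that remove \<open>K\<close> and \<open>U\<close> can be read off.\<close>

lemma sum_quad_weight:
  fixes v :: "'a \<Rightarrow> real"
  assumes fin: "finite (carrier G)" and x: "x \<in> carrier G"
    and sum0: "(\<Sum>a\<in>carrier G. v a) = 0"
  defines "n \<equiv> real (card (carrier G))" and "t \<equiv> real (card (square_roots \<one>))"
    and "K \<equiv> (\<Sum>c\<in>square_roots (x \<otimes> x). v c)"
    and "U \<equiv> (\<Sum>c\<in>carrier G. v (c \<otimes> c \<otimes> inv x))"
  shows "(\<Sum>b\<in>carrier G. \<Sum>c\<in>carrier G. quad_weight G \<alpha> \<beta> (x, b, c, x \<otimes> b \<otimes> inv c)
      * (v x + v b - v c - v (x \<otimes> b \<otimes> inv c)))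
    = ((n^2 - 3 * n + 2 * t) * v x - 2 * K - U) - \<alpha> * (n * ((t * n - n) * v x - U))
      - \<beta> * (2 * ((n - 2) * (t * v x - K)))"
    (is "?L = _")
proof -
  let ?d = "\<lambda>b c. x \<otimes> b \<otimes> inv c"
  let ?g = "\<lambda>b c. v x + v b - v c - v (?d b c)"
  have pointwise: "quad_weight G \<alpha> \<beta> (x, b, c, ?d b c) * ?g b c
     = (if b = x \<or> c = ?d b c then 0 else ?g b c)
      - \<alpha> * ((t - card (square_roots (x \<otimes> b))) * ?g b c)
      - \<beta> * (if b \<noteq> x \<and> x \<otimes> x = c \<otimes> c then ?g b c else 0)
      - \<beta> * (if b \<noteq> x \<and> x \<otimes> x = ?d b c \<otimes> ?d b c then ?g b c else 0)"
    if bc: "b \<in> carrier G" "c \<in> carrier G" for b c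
  proof (cases "b = x \<or> c = ?d b c")
    case False
    have "quad_weight G \<alpha> \<beta> (x, b, c, ?d b c)
        = 1 - \<alpha> * (t - card (square_roots (x \<otimes> b)))
          - \<beta> * (of_bool (x \<otimes> x = c \<otimes> c) + of_bool (x \<otimes> x = ?d b c \<otimes> ?d b c))"
      using False by (simp add: quad_weight_def t_def eq_commute[of b x])
    moreover have "(if b \<noteq> x \<and> P then y else 0) = of_bool P * y" for P and y :: real
      using False by simp
    ultimately show ?thesis using False by (simp only: if_False) (simp only: algebra_simps)
  next
    \<comment> \<open>The weight is 0 here, so the separate terms have to vanish as well. The
      product \<open>x b\<close> is the square of \<open>x\<close> or of \<open>c\<close>, which
      kills the \<alpha>-term. In the \<beta>-terms \<open>b = x\<close> is excluded, and
      \<open>c = d\<close> together with equal squares of \<open>x\<close> and \<open>c\<close>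
      would force it.\<close>
    case True
    have square: "x \<otimes> b = c \<otimes> c" if "c = ?d b c"
      using that x bc by (metis inv_solve_right m_closed)
    have "real (card (square_roots (x \<otimes> b))) = t"
      using True square x bc card_square_roots_square by (auto simp: t_def)
    moreover have "b = x" if "c = ?d b c" "x \<otimes> x = c \<otimes> c"
      using square[OF that(1)] that(2) x bc m_comm[of x b] right_cancel[of x b x] by simp
    hence "\<not> (b \<noteq> x \<and> x \<otimes> x = c \<otimes> c)" "\<not> (b \<noteq> x \<and> x \<otimes> x = ?d b c \<otimes> ?d b c)"
      using True by metis+
    moreover have "quad_weight G \<alpha> \<beta> (x, b, c, ?d b c) = 0"
      using True by (simp only: quad_weight_def prod.case) metis
    ultimately show ?thesis
      using True by (simp only: if_True if_False) simp
  qed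
  have "?L = (\<Sum>b\<in>carrier G. \<Sum>c\<in>carrier G. if b = x \<or> c = ?d b c then 0 else ?g b c)
     - \<alpha> * (\<Sum>b\<in>carrier G. \<Sum>c\<in>carrier G. (t - card (square_roots (x \<otimes> b))) * ?g b c)
     - \<beta> * (\<Sum>b\<in>carrier G. \<Sum>c\<in>carrier G. if b \<noteq> x \<and> x \<otimes> x = c \<otimes> c then ?g b c else 0)
     - \<beta> * (\<Sum>b\<in>carrier G. \<Sum>c\<in>carrier G. if b \<noteq> x \<and> x \<otimes> x = ?d b c \<otimes> ?d b c then ?g b c else 0)"
    by (simp only: pointwise sum_subtractf sum_distrib_left cong: sum.cong)
  also have "\<dots> = ((n^2 - 3 * n + 2 * t) * v x - 2 * K - U) - \<alpha> * (n * ((t * n - n) * v x - U))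
      - \<beta> * ((n - 2) * (t * v x - K)) - \<beta> * ((n - 2) * (t * v x - K))"
    unfolding n_def t_def K_def U_def
    by (simp only: sum_nondegenerate[OF fin x sum0] sum_nonsquare[OF fin x sum0]
        sum_square_eq_left[OF fin x sum0] sum_square_eq_right[OF fin x sum0])
  finally show ?thesis by (simp add: algebra_simps)
qed

lemma subgroup_square_roots_one: "subgroup (square_roots \<one>) G"
proof (rule subgroupI)
  show "x \<otimes> y \<in> square_roots \<one>" if "x \<in> square_roots \<one>" "y \<in> square_roots \<one>" for x y
  proof -
    have "(x \<otimes> y) \<otimes> (x \<otimes> y) = (x \<otimes> x) \<otimes> (y \<otimes> y)"
      using that by (simp add: square_roots_def m_ac)
    thus ?thesis using that by (simp add: square_roots_def)
  qed
  show "inv x \<in> square_roots \<one>" if "x \<in> square_roots \<one>" for x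
    using that by (auto simp: square_roots_def inv_mult_group[symmetric])
qed (auto simp: square_roots_def)

text \<open>The product of the two nontrivial roots would have to be one or a factor of itself,
  against their being distinct and nontrivial.\<close>

lemma card_square_roots_one_ne_3: "card (square_roots \<one>) \<noteq> 3"
proof
  let ?B = "square_roots \<one>"
  note m_closed' = subgroup.m_closed[OF subgroup_square_roots_one]
    and one_closed' = subgroup.one_closed[OF subgroup_square_roots_one]
  assume three: "card ?B = 3"
  hence "card (?B - {\<one>}) = 2"
    by (simp add: card_Diff_singleton one_closed')
  then obtain x y where xy: "?B - {\<one>} = {x, y}" "x \<noteq> y" unfolding card_2_iff by blast
  have carr: "x \<in> carrier G" "y \<in> carrier G" "x \<otimes> x = \<one>" "y \<otimes> y = \<one>" "x \<noteq> \<one>" "y \<noteq> \<one>"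
  proof -
    have "x \<in> ?B - {\<one>}" "y \<in> ?B - {\<one>}" unfolding xy by simp_all
    thus "x \<in> carrier G" "y \<in> carrier G" "x \<otimes> x = \<one>" "y \<otimes> y = \<one>" "x \<noteq> \<one>" "y \<noteq> \<one>"
      unfolding square_roots_def by blast+
  qed
  have "x \<otimes> y \<in> ?B" using xy(1) by (intro m_closed') blast+
  moreover have "?B = {\<one>, x, y}" using insert_Diff[OF one_closed'] xy(1) by metis
  ultimately consider "x \<otimes> y = \<one>" | "x \<otimes> y = x" | "x \<otimes> y = y" by auto
  thus False
    using carr xy(2) by cases (metis inv_equality inv_unique', simp_all)
qed

text \<open>With denominators cleared this is the positivity of
  \<open>1 - t / n - 2 / (n - 2)\<close>, a lower bound for the weight on proper quads. As
  \<open>t\<close> is a proper divisor of \<open>n\<close>, \<open>2 * t \<le> n\<close>, which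
  suffices from order 7 on.\<close>

lemma square_roots_one_bound:
  assumes fin: "finite (carrier G)" and n: "card (carrier G) \<ge> 5"
    and x: "x \<in> carrier G" "x \<otimes> x \<noteq> \<one>"
  defines "n \<equiv> card (carrier G)" and "t \<equiv> card (square_roots \<one>)"
  shows "t * (n - 2) < n * (n - 4)"
proof -
  have "t dvd n"
    using lagrange[OF subgroup_square_roots_one] by (metis dvd_triv_right n_def t_def order_def)
  then obtain m where m: "n = t * m" by auto
  have "square_roots \<one> \<subset> carrier G" using x by (auto simp: square_roots_def)
  hence "t < n" unfolding n_def t_def by (rule psubset_card_mono[OF fin])
  have "m \<ge> 2"
    using m \<open>t < n\<close> by (cases m; cases "m - 1") auto
  hence t: "2 * t \<le> n" using m by simp
  have "t \<noteq> 3" using card_square_roots_one_ne_3 by (simp add: t_def)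
  have n5: "n \<ge> 5" using n by (simp add: n_def)
  \<comment> \<open>At order 5 the value \<open>t = 2\<close> would violate the bound, and
    divisibility rules it out. At order 6 the value \<open>t = 3\<close> would give equality, and it
    is excluded by \<open>card_square_roots_one_ne_3\<close>.\<close>
  consider "n = 5" | "n = 6" | "n \<ge> 7" using n5 by linarith
  thus ?thesis
  proof cases
    case 1
    with \<open>t dvd n\<close> t have "t = 1"
      by (cases "t = 0 \<or> t = 2") auto
    thus ?thesis using 1 by simp
  next
    case 2
    thus ?thesis using t \<open>t \<noteq> 3\<close> by simp
  next
    case 3
    then obtain k where k: "n = k + 7" by (metis add.commute le_Suc_ex)
    have "2 * (t * (n - 2)) \<le> n * (n - 2)" using t by simp
    also have "\<dots> < 2 * (n * (n - 4))" using k by (simp add: algebra_simps)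
    finally show ?thesis by simp
  qed
qed

end

section \<open>Scalar weighted sums on the real augmentation ideal\<close>

definition aug_space :: "('a::finite, 'm) monoid_scheme \<Rightarrow> (real ^ 'a) set"
  where "aug_space A = {v. (\<forall>x. x \<notin> carrier A \<longrightarrow> v $ x = 0) \<and> (\<Sum>x\<in>carrier A. v $ x) = 0}"

lemma quad_weights_exist:
  fixes A :: "('a::finite, 'm) monoid_scheme"
  assumes "comm_group A" and n4: "card (carrier A) \<ge> 4"
    and alt: "(\<forall>x\<in>carrier A. x \<otimes>\<^bsub>A\<^esub> x = \<one>\<^bsub>A\<^esub>) \<or> card (carrier A) \<ge> 5"
  obtains l \<alpha> \<beta> where "l > 0" "\<And>q. q \<in> proper_quads A \<Longrightarrow> quad_weight A \<alpha> \<beta> q > 0"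
    "\<And>v. v \<in> aug_space A \<Longrightarrow>
      (\<Sum>q\<in>quads A. quad_weight A \<alpha> \<beta> q *\<^sub>R proj_along (quad_vec q) v) = (4 * l) *\<^sub>R v"
proof -
  interpret comm_group A by fact
  define n where "n = real (card (carrier A))"
  define t where "t = real (card (square_roots \<one>\<^bsub>A\<^esub>))"
  have fin: "finite (carrier A)" by simp
  have n: "n \<ge> 4" using n4 by (simp add: n_def)
  note sumW = sum_quad_weight[OF fin, folded n_def t_def]
  show ?thesis
  proof (cases "\<forall>x\<in>carrier A. x \<otimes>\<^bsub>A\<^esub> x = \<one>\<^bsub>A\<^esub>")
    case True
    have roots: "square_roots \<one>\<^bsub>A\<^esub> = carrier A" using True by (auto simp: square_roots_def)
    show ?thesis
    \<comment> \<open>All squares are one, so \<open>K\<close> is the sum of \<open>v\<close> over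
      the carrier and vanishes, while \<open>U\<close> is \<open>n\<close> times the value at
      \<open>x\<close>. Constant weights already give a scalar.\<close>
    proof (rule that[of "n * (n - 2)" 0 0])
      show "0 < n * (n - 2)" using n by simp
      show "quad_weight A 0 0 q > 0" if "q \<in> proper_quads A" for q
        using that by (auto simp: quad_weight_def proper_quads_def)
      show "(\<Sum>q\<in>quads A. quad_weight A 0 0 q *\<^sub>R proj_along (quad_vec q) v) = (4 * (n * (n - 2))) *\<^sub>R v"
        if v: "v \<in> aug_space A" for v
      proof (rule quad_sum_eq[OF assms(1)])
        fix x assume x: "x \<in> carrier A"
        have "inv\<^bsub>A\<^esub> x = x" using x True by (simp add: inv_equality)
        hence U: "(\<Sum>c\<in>carrier A. v $ (c \<otimes>\<^bsub>A\<^esub> c \<otimes>\<^bsub>A\<^esub> inv\<^bsub>A\<^esub> x)) = n * v $ x"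
          using x True by (simp add: n_def)
        have K: "(\<Sum>c\<in>square_roots (x \<otimes>\<^bsub>A\<^esub> x). v $ c) = 0"
          using x True roots v by (simp add: aug_space_def)
        have "t = n" by (simp add: t_def n_def roots)
        show "(\<Sum>b\<in>carrier A. \<Sum>c\<in>carrier A. quad_weight A 0 0 (x, b, c, x \<otimes>\<^bsub>A\<^esub> b \<otimes>\<^bsub>A\<^esub> inv\<^bsub>A\<^esub> c)
            * (v $ x + v $ b - v $ c - v $ (x \<otimes>\<^bsub>A\<^esub> b \<otimes>\<^bsub>A\<^esub> inv\<^bsub>A\<^esub> c))) = n * (n - 2) * v $ x"
          using v unfolding aug_space_def
          by (subst sumW[OF x], blast, subst K, subst U) (simp add: \<open>t = n\<close> power2_eq_square algebra_simps)
      qed (use v quad_weight_sym in \<open>auto simp: aug_space_def\<close>)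
    qed
  next
    case False
    then obtain y where y: "y \<in> carrier A" "y \<otimes>\<^bsub>A\<^esub> y \<noteq> \<one>\<^bsub>A\<^esub>" by auto
    have n5: "card (carrier A) \<ge> 5" using alt False by auto
    have "real (card (square_roots \<one>\<^bsub>A\<^esub>) * (card (carrier A) - 2)) < real (card (carrier A) * (card (carrier A) - 4))"
      using square_roots_one_bound[OF fin n5 y] by (simp only: of_nat_less_iff)
    hence bound: "t * (n - 2) < n * (n - 4)"
      using n4 by (simp add: n_def t_def of_nat_diff)
    hence l: "n - 2 - t > 0"
    proof -
      have "t * (n - 2) < (n - 2) * (n - 2)"
        using bound by (rule less_le_trans) (simp add: algebra_simps)
      thus ?thesis using n by (simp add: mult_less_cancel_right)
    qed
    have pos: "1 - t / n - 2 / (n - 2) > 0"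
      using bound n by (simp add: field_simps)
    \<comment> \<open>The two coefficients cancel \<open>U\<close> and \<open>K\<close> in
      \<open>sum_quad_weight\<close>. What remains in front of \<open>v x\<close> is
      \<open>n^2 - 3 * n + 2 * t - (t * n - n) - 2 * t = n * (n - 2 - t)\<close>.\<close>
    show ?thesis
    proof (rule that[of "n * (n - 2 - t)" "1 / n" "1 / (n - 2)"])
      show "0 < n * (n - 2 - t)" using n l by simp
      show "quad_weight A (1 / n) (1 / (n - 2)) q > 0" if q: "q \<in> proper_quads A" for q
      proof -
        obtain a b c d where q': "q = (a, b, c, d)" by (cases q)
        define r where "r = real (card (square_roots (a \<otimes>\<^bsub>A\<^esub> b)))"
        define s :: real where "s = of_bool (a \<otimes>\<^bsub>A\<^esub> a = c \<otimes>\<^bsub>A\<^esub> c) + of_bool (a \<otimes>\<^bsub>A\<^esub> a = d \<otimes>\<^bsub>A\<^esub> d)"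
        have "quad_weight A (1 / n) (1 / (n - 2)) q = 1 - 1 / n * (t - r) - 1 / (n - 2) * s"
          using q by (simp add: q' quad_weight_def proper_quads_def t_def r_def s_def)
        moreover have "1 / n * (t - r) \<le> t / n"
          using n by (simp add: field_simps r_def)
        moreover have "1 / (n - 2) * s \<le> 2 / (n - 2)"
          using n by (simp add: field_simps s_def)
        ultimately show ?thesis using pos by linarith
      qed
      show "(\<Sum>q\<in>quads A. quad_weight A (1 / n) (1 / (n - 2)) q *\<^sub>R proj_along (quad_vec q) v)
          = (4 * (n * (n - 2 - t))) *\<^sub>R v"
        if v: "v \<in> aug_space A" for v
      proof (rule quad_sum_eq[OF assms(1)])
        have scale: "1 / n * (n * y) = y" "1 / (n - 2) * (2 * ((n - 2) * y)) = 2 * y" for y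
          using n by simp_all
        fix x assume x: "x \<in> carrier A"
        show "(\<Sum>b\<in>carrier A. \<Sum>c\<in>carrier A. quad_weight A (1 / n) (1 / (n - 2)) (x, b, c, x \<otimes>\<^bsub>A\<^esub> b \<otimes>\<^bsub>A\<^esub> inv\<^bsub>A\<^esub> c)
            * (v $ x + v $ b - v $ c - v $ (x \<otimes>\<^bsub>A\<^esub> b \<otimes>\<^bsub>A\<^esub> inv\<^bsub>A\<^esub> c))) = n * (n - 2 - t) * v $ x"
          using v unfolding aug_space_def
          by (subst sumW[OF x], blast, simp only: scale)
            (simp add: power2_eq_square algebra_simps)
      qed (use v quad_weight_sym in \<open>auto simp: aug_space_def\<close>)
    qed
  qed
qed

lemma quad_vec_in_aug_space: "q \<in> quads A \<Longrightarrow> quad_vec q \<in> aug_space A"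
  by (auto simp: quads_def quad_vec_def aug_space_def axis_def sum.distrib sum_subtractf)

text \<open>The other quads drop out of the weighted sum: their weight is 0, or \<open>a = c\<close>
  or \<open>a = d\<close> makes their vector 0. The space \<open>V\<close> is left open because it
  is taken once as \<open>aug_space A\<close>, to see that proper quads exist, and once as the span
  of the lattice.\<close>

lemma eutactic_quads:
  fixes A :: "('a::finite, 'm) monoid_scheme"
  assumes "comm_group A" and "card (carrier A) \<ge> 4"
    and "(\<forall>x\<in>carrier A. x \<otimes>\<^bsub>A\<^esub> x = \<one>\<^bsub>A\<^esub>) \<or> card (carrier A) \<ge> 5"
    and "V \<subseteq> aug_space A" "quad_vec ` proper_quads A \<subseteq> V"
  shows "eutactic_in V (quad_vec ` proper_quads A)"
proof -
  interpret comm_group A by fact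
  obtain l \<alpha> \<beta> where W: "l > 0" "\<And>q. q \<in> proper_quads A \<Longrightarrow> quad_weight A \<alpha> \<beta> q > 0"
    "\<And>v. v \<in> aug_space A \<Longrightarrow>
      (\<Sum>q\<in>quads A. quad_weight A \<alpha> \<beta> q *\<^sub>R proj_along (quad_vec q) v) = (4 * l) *\<^sub>R v"
    using quad_weights_exist[OF assms(1-3)] by blast
  show ?thesis
  proof (rule eutactic_inI)
    fix v assume "v \<in> V"
    have degenerate: "quad_weight A \<alpha> \<beta> q *\<^sub>R proj_along (quad_vec q) v = 0"
      if "q \<in> quads A - proper_quads A" for q
    proof -
      obtain a b c d where q: "q = (a, b, c, d)" by (cases q)
      have "quad_vec q = (0 :: real ^ 'a)" if "a = c \<or> a = d"
        using that \<open>q \<in> quads A - proper_quads A\<close> by (auto simp: q quads_def quad_vec_def m_comm[of d])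
      thus ?thesis
        using that by (auto simp: q proper_quads_def quad_weight_def proj_along_def)
    qed
    have "(\<Sum>q\<in>proper_quads A. quad_weight A \<alpha> \<beta> q *\<^sub>R proj_along (quad_vec q) v)
      = (\<Sum>q\<in>quads A. quad_weight A \<alpha> \<beta> q *\<^sub>R proj_along (quad_vec q) v)"
      using degenerate by (intro sum.mono_neutral_left) (auto simp: proper_quads_def)
    thus "(\<Sum>q\<in>proper_quads A. quad_weight A \<alpha> \<beta> q *\<^sub>R proj_along (quad_vec q) v) = (4 * l) *\<^sub>R v"
      using W(3) \<open>v \<in> V\<close> assms(4) by auto
  qed (use W(1,2) assms(5) in simp_all)
qed

subsection \<open>Minimal vectors of the lattice\<close>

definition relations :: "('a::finite, 'm) monoid_scheme \<Rightarrow> (int ^ 'a) set"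
  where "relations A = psi_kernel A \<inter> augmentation_ideal A"

text \<open>The squared norm is kept integral, so that bounds on it can be sharpened by integer
  arithmetic.\<close>

definition int_norm_sq :: "int ^ 'a::finite \<Rightarrow> int"
  where "int_norm_sq k = (\<Sum>x\<in>UNIV. (k $ x)\<^sup>2)"

text \<open>For \<open>a\<close> in the carrier, this is the group order times the orthogonal
  projection of the basis vector at \<open>a\<close> onto the sum-zero vectors supported on the
  carrier.\<close>

definition point_vec :: "('a::finite, 'm) monoid_scheme \<Rightarrow> 'a \<Rightarrow> int ^ 'a"
  where "point_vec A a =
    (\<chi> x. if x = a then int (card (carrier A)) - 1 else if x \<in> carrier A then - 1 else 0)"

lemma group_lattice_eq: "group_lattice A = real_coeffs ` relations A"
  by (simp add: group_lattice_def relations_def)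

lemma real_coeffs_nth [simp]: "real_coeffs k $ x = real_of_int (k $ x)"
  by (simp add: real_coeffs_def)

lemma real_coeffs_eq_0_iff [simp]: "real_coeffs k = 0 \<longleftrightarrow> k = 0"
  by (simp add: vec_eq_iff)

lemma real_coeffs_quad_vec: "real_coeffs (quad_vec q) = quad_vec q"
  by (cases q) (auto simp: vec_eq_iff quad_vec_def axis_def)

lemma norm_real_coeffs: "norm (real_coeffs k) = sqrt (real_of_int (int_norm_sq k))"
  by (simp add: norm_eq_sqrt_inner inner_vec_def int_norm_sq_def power2_eq_square)

lemma relationsD:
  assumes "k \<in> relations A"
  shows "x \<notin> carrier A \<Longrightarrow> k $ x = 0" "(\<Sum>x\<in>carrier A. k $ x) = 0" "(\<Sum>x\<in>UNIV. k $ x) = 0"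
    "psi A k = \<one>\<^bsub>A\<^esub>"
proof -
  show *: "k $ x = 0" if "x \<notin> carrier A" for x
    using assms that by (simp add: relations_def psi_kernel_def int_group_ring_def)
  show "(\<Sum>x\<in>carrier A. k $ x) = 0" "psi A k = \<one>\<^bsub>A\<^esub>"
    using assms by (simp_all add: relations_def psi_kernel_def augmentation_ideal_def)
  moreover have "(\<Sum>x\<in>UNIV. k $ x) = (\<Sum>x\<in>carrier A. k $ x)"
    using * by (intro sum.mono_neutral_right) auto
  ultimately show "(\<Sum>x\<in>UNIV. k $ x) = 0" by simp
qed

lemma relationsI:
  assumes "\<And>x. x \<notin> carrier A \<Longrightarrow> k $ x = 0" "(\<Sum>x\<in>carrier A. k $ x) = 0" "psi A k = \<one>\<^bsub>A\<^esub>"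
  shows "k \<in> relations A"
  using assms by (auto simp: relations_def psi_kernel_def augmentation_ideal_def int_group_ring_def)

section \<open>Quad vectors as members of the lattice\<close>

context
  fixes A :: "('a::finite, 'm) monoid_scheme"
  assumes A: "comm_group A"
begin

interpretation comm_group A by (rule A)

lemma psi_closed: "psi A k \<in> carrier A"
  by (auto simp: psi_def intro!: finprod_closed)

lemma psi_add: "psi A (k + l) = psi A k \<otimes>\<^bsub>A\<^esub> psi A l"
proof -
  have "psi A (k + l) = finprod A (\<lambda>a. a [^]\<^bsub>A\<^esub> (k $ a) \<otimes>\<^bsub>A\<^esub> a [^]\<^bsub>A\<^esub> (l $ a)) (carrier A)"
    unfolding psi_def by (rule finprod_cong') (auto simp: int_pow_mult)
  also have "\<dots> = psi A k \<otimes>\<^bsub>A\<^esub> psi A l"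
    unfolding psi_def by (rule finprod_multf) auto
  finally show ?thesis .
qed

lemma psi_diff: "psi A (k - l) = psi A k \<otimes>\<^bsub>A\<^esub> inv\<^bsub>A\<^esub> psi A l"
  using psi_add[of "k - l" l] psi_closed by (simp add: inv_solve_right)

lemma psi_axis: "a \<in> carrier A \<Longrightarrow> psi A (axis a 1) = a"
proof -
  assume a: "a \<in> carrier A"
  have "psi A (axis a 1) = finprod A (\<lambda>x. if a = x then x else \<one>\<^bsub>A\<^esub>) (carrier A)"
    unfolding psi_def by (rule finprod_cong') (auto simp: axis_def)
  also have "\<dots> = a"
    using a by (intro finprod_singleton) auto
  finally show ?thesis .
qed

lemma relations_minus: "k \<in> relations A \<Longrightarrow> - k \<in> relations A"
proof (rule relationsI)
  assume k: "k \<in> relations A"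
  have "psi A 0 = \<one>\<^bsub>A\<^esub>" by (simp add: psi_def)
  thus "psi A (- k) = \<one>\<^bsub>A\<^esub>" using psi_diff[of 0 k] relationsD(4)[OF k] by simp
qed (auto simp: relationsD sum_negf)

lemma psi_quad_vec:
  assumes "a \<in> carrier A" "b \<in> carrier A" "c \<in> carrier A" "d \<in> carrier A"
  shows "psi A (quad_vec (a, b, c, d)) = a \<otimes>\<^bsub>A\<^esub> b \<otimes>\<^bsub>A\<^esub> inv\<^bsub>A\<^esub> c \<otimes>\<^bsub>A\<^esub> inv\<^bsub>A\<^esub> d"
  using assms by (simp add: quad_vec_def psi_diff psi_add psi_axis)

lemma quad_vec_in_relations:
  assumes "q \<in> quads A"
  shows "quad_vec q \<in> relations A"
proof -
  obtain a b c d where q: "q = (a, b, c, d)" by (cases q)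
  have carr: "a \<in> carrier A" "b \<in> carrier A" "c \<in> carrier A" "d \<in> carrier A"
    "a \<otimes>\<^bsub>A\<^esub> b = c \<otimes>\<^bsub>A\<^esub> d" using assms by (auto simp: q quads_def)
  show ?thesis
  proof (rule relationsI)
    show "psi A (quad_vec q) = \<one>\<^bsub>A\<^esub>"
      unfolding q psi_quad_vec[OF carr(1-4)] carr(5)
      using carr(3,4) m_comm[of c d] by (simp add: m_assoc)
  qed (use carr in \<open>auto simp: q quad_vec_def axis_def sum.distrib sum_subtractf\<close>)
qed

lemma proper_quads_distinct:
  assumes "(a, b, c, d) \<in> proper_quads A"
  shows "distinct [a, b, c, d]"
  using assms m_comm[of a c] m_comm[of c a] m_comm[of a d] m_comm[of d a] m_comm[of c d]
  by (auto simp: proper_quads_def quads_def)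

lemma int_norm_sq_quad_vec:
  assumes "q \<in> proper_quads A"
  shows "int_norm_sq (quad_vec q) = 4"
proof -
  obtain a b c d where q: "q = (a, b, c, d)" by (cases q)
  have "distinct [a, b, c, d]" using assms proper_quads_distinct by (simp add: q)
  hence "int_norm_sq (quad_vec q) = (\<Sum>x\<in>UNIV. (if x = a then 1 else 0) + (if x = b then 1 else 0)
      + (if x = c then 1 else 0) + (if x = d then 1 else (0::int)))"
    unfolding int_norm_sq_def by (intro sum.cong) (auto simp: q quad_vec_def axis_def)
  thus ?thesis by (simp add: sum.distrib)
qed

end

text \<open>A nonzero vector with sum zero has entries of both signs. Moving one of each sign by one
  towards zero keeps the sum and lowers the squared norm by at least 2.\<close>

lemma remove_axes:
  fixes k :: "int ^ 'a::finite"
  assumes "(\<Sum>x\<in>UNIV. k $ x) = 0" "k \<noteq> 0"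
  obtains a c where "k $ a > 0" "k $ c < 0" "(\<Sum>x\<in>UNIV. (k - axis a 1 + axis c 1) $ x) = 0"
    "int_norm_sq (k - axis a 1 + axis c 1) = int_norm_sq k - 2 * k $ a + 2 * k $ c + 2"
proof -
  have "\<exists>a. k $ a > 0"
  proof (rule ccontr)
    assume "\<nexists>a. k $ a > 0"
    hence "\<forall>x\<in>UNIV. - k $ x = 0"
      using assms(1) by (subst sum_nonneg_eq_0_iff[symmetric]) (auto simp: sum_negf not_less)
    with assms(2) show False by (simp add: vec_eq_iff)
  qed
  then obtain a where a: "k $ a > 0" by blast
  have "\<exists>c. k $ c < 0"
  proof (rule ccontr)
    assume "\<nexists>c. k $ c < 0"
    hence "\<forall>x\<in>UNIV. k $ x = 0"
      using assms(1) by (subst sum_nonneg_eq_0_iff[symmetric]) (auto simp: not_less)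
    with assms(2) show False by (simp add: vec_eq_iff)
  qed
  then obtain c where c: "k $ c < 0" by blast
  have "int_norm_sq (k - axis a 1 + axis c 1)
      = (\<Sum>x\<in>UNIV. (k $ x)\<^sup>2 + (if x = a then 1 - 2 * k $ a else 0) + (if x = c then 1 + 2 * k $ c else 0))"
    unfolding int_norm_sq_def using a c
    by (intro sum.cong) (auto simp: axis_def power2_eq_square algebra_simps)
  also have "\<dots> = int_norm_sq k - 2 * k $ a + 2 * k $ c + 2"
    by (simp add: sum.distrib int_norm_sq_def)
  finally show ?thesis
    using a c assms(1) by (intro that[of a c]) (simp_all add: sum.distrib sum_subtractf axis_def)
qed

lemma int_norm_sq_nonneg: "int_norm_sq k \<ge> 0"
  by (simp add: int_norm_sq_def sum_nonneg)

lemma int_norm_sq_eq_0_iff: "int_norm_sq k = 0 \<longleftrightarrow> k = 0"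
  by (simp add: int_norm_sq_def sum_nonneg_eq_0_iff vec_eq_iff)

lemma short_relations:
  fixes A :: "('a::finite, 'm) monoid_scheme"
  assumes A: "comm_group A" and k: "k \<in> relations A" "k \<noteq> 0" and short: "int_norm_sq k \<le> 4"
  shows "\<exists>q\<in>proper_quads A. k = quad_vec q"
proof -
  interpret comm_group A by (rule A)
  obtain a c where ac: "k $ a > 0" "k $ c < 0" "(\<Sum>x\<in>UNIV. (k - axis a 1 + axis c 1) $ x) = 0"
    "int_norm_sq (k - axis a 1 + axis c 1) = int_norm_sq k - 2 * k $ a + 2 * k $ c + 2"
    using remove_axes[OF relationsD(3)[OF k(1)] k(2)] by blast
  define l where "l = k - axis a 1 + axis c 1"
  have carr: "a \<in> carrier A" "c \<in> carrier A" using ac(1,2) relationsD(1)[OF k(1)] by force+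
  have "a \<noteq> c" using ac by auto
  \<comment> \<open>Otherwise \<open>k\<close> would be a difference of two basis vectors, and
    \<open>psi\<close> would identify \<open>a\<close> with \<open>c\<close>.\<close>
  have "l \<noteq> 0"
  proof
    assume "l = 0"
    hence "k = axis a 1 - axis c 1" by (simp add: l_def algebra_simps)
    hence "a \<otimes>\<^bsub>A\<^esub> inv\<^bsub>A\<^esub> c = \<one>\<^bsub>A\<^esub>"
      using relationsD(4)[OF k(1)] carr by (simp add: psi_diff[OF A] psi_axis[OF A])
    with \<open>a \<noteq> c\<close> carr show False by (metis inv_equality inv_inv inv_closed)
  qed
  then obtain b d where bd: "l $ b > 0" "l $ d < 0"
    "int_norm_sq (l - axis b 1 + axis d 1) = int_norm_sq l - 2 * l $ b + 2 * l $ d + 2"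
    using remove_axes[of l] ac(3) unfolding l_def by blast
  have lx: "l $ x = k $ x - of_bool (x = a) + of_bool (x = c)" for x
    by (auto simp: l_def axis_def)
  have nl: "int_norm_sq l = int_norm_sq k - 2 * k $ a + 2 * k $ c + 2"
    using ac(4) by (simp add: l_def)
  note ge = int_norm_sq_nonneg[of "l - axis b 1 + axis d 1"]
  \<comment> \<open>Each of the two removals costs at least 2, so nothing is left of a squared norm
    of at most 4.\<close>
  have "int_norm_sq (l - axis b 1 + axis d 1) = 0"
    using ge bd nl ac short by linarith
  hence "l - axis b 1 + axis d 1 = 0" by (simp only: int_norm_sq_eq_0_iff)
  hence keq: "k = quad_vec (a, b, c, d)"
    by (simp add: l_def quad_vec_def algebra_simps)
  \<comment> \<open>There is no slack in either removal, so the first one took entries of absolute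
    value 1. Hence \<open>l\<close> vanishes at \<open>a\<close> and \<open>c\<close>, which keeps
    \<open>b\<close> and \<open>d\<close> away from them.\<close>
  have "k $ a = 1" "k $ c = - 1" using ge bd nl ac short by linarith+
  have "b \<noteq> c" "d \<noteq> a" using bd(1,2) lx ac \<open>a \<noteq> c\<close> by (auto split: if_splits)
  have "b \<noteq> a" "d \<noteq> c"
    using bd(1,2) \<open>k $ a = 1\<close> \<open>k $ c = - 1\<close> \<open>a \<noteq> c\<close> by (auto simp: lx)
  have "k $ b > 0" "k $ d < 0"
    using bd(1,2) \<open>b \<noteq> a\<close> \<open>b \<noteq> c\<close> \<open>d \<noteq> a\<close> \<open>d \<noteq> c\<close> by (auto simp: lx)
  hence carr': "b \<in> carrier A" "d \<in> carrier A" using relationsD(1)[OF k(1)] by force+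
  have "a \<otimes>\<^bsub>A\<^esub> b \<otimes>\<^bsub>A\<^esub> inv\<^bsub>A\<^esub> c \<otimes>\<^bsub>A\<^esub> inv\<^bsub>A\<^esub> d = \<one>\<^bsub>A\<^esub>"
    using relationsD(4)[OF k(1)] unfolding keq psi_quad_vec[OF A carr(1) carr'(1) carr(2) carr'(2)] .
  hence "a \<otimes>\<^bsub>A\<^esub> b = c \<otimes>\<^bsub>A\<^esub> d"
    using carr carr' m_comm[of c d] by (simp add: inv_solve_right')
  thus ?thesis
    using keq carr carr' \<open>a \<noteq> c\<close> \<open>b \<noteq> a\<close> \<open>d \<noteq> c\<close> \<open>d \<noteq> a\<close>
    by (intro bexI[of _ "(a, b, c, d)"]) (auto simp: proper_quads_def quads_def)
qed

section \<open>Lattices whose minimal vectors are the proper quad vectors\<close>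

lemma subspace_aug_space: "subspace (aug_space A)"
  by (auto simp: subspace_def aug_space_def sum.distrib sum_distrib_left[symmetric])

lemma real_coeffs_in_aug_space: "k \<in> relations A \<Longrightarrow> real_coeffs k \<in> aug_space A"
  by (auto simp: aug_space_def relationsD simp flip: of_int_sum)

lemma span_group_lattice: "span (group_lattice A) \<subseteq> aug_space A"
  by (rule span_minimal)
    (auto simp: group_lattice_eq real_coeffs_in_aug_space subspace_aug_space)

lemma min_vecs_eqI:
  assumes "m > 0" "s0 \<in> L" "norm s0 = m" "\<And>s. s \<in> L \<Longrightarrow> s \<noteq> 0 \<Longrightarrow> norm s \<ge> m"
  shows "min_vecs L = {s \<in> L. norm s = m}"
proof -
  have "s0 \<noteq> 0" using assms by auto
  hence "min_dist L = m"
    unfolding min_dist_def by (intro Least_equality) (use assms in auto)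
  thus ?thesis using \<open>s0 \<noteq> 0\<close> assms(2) by (auto simp: min_vecs_def)
qed

lemma min_vecs_group_lattice:
  assumes "m > 0" "k0 \<in> relations A" "int_norm_sq k0 = m"
    "\<And>k. k \<in> relations A \<Longrightarrow> k \<noteq> 0 \<Longrightarrow> int_norm_sq k \<ge> m"
  shows "min_vecs (group_lattice A) = real_coeffs ` {k \<in> relations A. int_norm_sq k = m}"
  by (subst min_vecs_eqI[of "sqrt m" "real_coeffs k0"])
    (use assms in \<open>auto simp: group_lattice_eq norm_real_coeffs\<close>)

lemma eutactic_large:
  fixes A :: "('a::finite, 'm) monoid_scheme"
  assumes A: "comm_group A" and n: "card (carrier A) \<ge> 4"
    and alt: "(\<forall>x\<in>carrier A. x \<otimes>\<^bsub>A\<^esub> x = \<one>\<^bsub>A\<^esub>) \<or> card (carrier A) \<ge> 5"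
  shows "eutactic_lattice_in (span (group_lattice A)) (group_lattice A)"
proof -
  \<comment> \<open>Existence comes from eutaxy itself: an empty eutactic set forces the
    augmentation space to be zero, yet it contains the difference of two basis vectors.\<close>
  have "proper_quads A \<noteq> {}"
  proof
    assume empty: "proper_quads A = {}"
    have "\<exists>a b. a \<in> carrier A \<and> b \<in> carrier A \<and> a \<noteq> b"
    proof (rule ccontr)
      assume "\<not> ?thesis"
      hence "card (carrier A) \<le> Suc 0" by (subst card_le_Suc0_iff_eq) auto
      with n show False by simp
    qed
    then obtain a b where ab: "a \<in> carrier A" "b \<in> carrier A" "a \<noteq> b" by blast
    let ?v = "axis a 1 - axis b 1 :: real ^ 'a"
    have "?v \<in> aug_space A" using ab by (auto simp: aug_space_def axis_def sum_subtractf)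
    moreover have "eutactic_in (aug_space A) (quad_vec ` proper_quads A)"
      by (rule eutactic_quads[OF A n alt])
        (auto simp: proper_quads_def intro!: quad_vec_in_aug_space)
    hence "\<forall>v\<in>aug_space A. v = 0" by (simp add: eutactic_in_def empty)
    ultimately have "?v = 0" by blast
    thus False using ab by (auto simp: vec_eq_iff axis_def split: if_splits)
  qed
  then obtain q0 where q0: "q0 \<in> proper_quads A" by blast
  have quads: "q \<in> proper_quads A \<Longrightarrow> q \<in> quads A" for q by (auto simp: proper_quads_def)
  have "min_vecs (group_lattice A) = real_coeffs ` {k \<in> relations A. int_norm_sq k = 4}"
  proof (rule min_vecs_group_lattice)
    show "quad_vec q0 \<in> relations A" using q0 quads quad_vec_in_relations[OF A] by blast
    show "int_norm_sq (quad_vec q0) = 4" using q0 int_norm_sq_quad_vec[OF A] by blast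
    show "4 \<le> int_norm_sq k" if "k \<in> relations A" "k \<noteq> 0" for k
      using short_relations[OF A that] int_norm_sq_quad_vec[OF A] by fastforce
  qed simp
  also have "{k \<in> relations A. int_norm_sq k = 4} = quad_vec ` proper_quads A"
  proof (intro equalityI subsetI)
    fix k assume "k \<in> {k \<in> relations A. int_norm_sq k = 4}"
    moreover from this have "k \<noteq> 0" by (auto simp: int_norm_sq_def)
    ultimately show "k \<in> quad_vec ` proper_quads A" using short_relations[OF A, of k] by auto
  next
    fix k :: "int ^ 'a" assume "k \<in> quad_vec ` proper_quads A"
    thus "k \<in> {k \<in> relations A. int_norm_sq k = 4}"
      using quads quad_vec_in_relations[OF A] int_norm_sq_quad_vec[OF A] by blast
  qed
  also have "real_coeffs ` \<dots> = quad_vec ` proper_quads A"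
    by (simp add: image_image real_coeffs_quad_vec)
  finally have min: "min_vecs (group_lattice A) = quad_vec ` proper_quads A" .
  show ?thesis
    unfolding eutactic_lattice_in_def min
  proof (rule eutactic_quads[OF A n alt span_group_lattice])
    show "quad_vec ` proper_quads A \<subseteq> span (group_lattice A)"
    proof
      fix y :: "real ^ 'a" assume "y \<in> quad_vec ` proper_quads A"
      then obtain q where "q \<in> proper_quads A" "y = real_coeffs (quad_vec q)"
        by (auto simp: real_coeffs_quad_vec)
      moreover from this have "quad_vec q \<in> relations A"
        using quad_vec_in_relations[OF A] quads by blast
      ultimately show "y \<in> span (group_lattice A)"
        by (auto simp: group_lattice_eq intro!: span_base)
    qed
  qed
qed


section \<open>Point vectors and the groups of order two and three\<close>

lemma int_norm_sq_point_vec: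
  assumes "a \<in> carrier A"
  shows "int_norm_sq (c *s point_vec A a) = c\<^sup>2 * (int (card (carrier A)) * (int (card (carrier A)) - 1))"
proof -
  let ?n = "int (card (carrier A))"
  have "int_norm_sq (c *s point_vec A a)
      = (\<Sum>x\<in>UNIV. c\<^sup>2 * ((if x \<in> carrier A then 1 else 0) + (if x = a then (?n - 1)\<^sup>2 - 1 else 0)))"
    unfolding int_norm_sq_def using assms
    by (intro sum.cong) (auto simp: point_vec_def power_mult_distrib)
  also have "\<dots> = c\<^sup>2 * (?n + ((?n - 1)\<^sup>2 - 1))"
    unfolding sum_distrib_left[symmetric] sum.distrib by (simp add: sum.If_cases)
  also have "?n + ((?n - 1)\<^sup>2 - 1) = ?n * (?n - 1)"
    by (simp add: power2_eq_square algebra_simps)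
  finally show ?thesis .
qed

lemma inner_point_vec:
  fixes c :: int
  assumes "v \<in> aug_space A" "a \<in> carrier A"
  shows "v \<bullet> real_coeffs (c *s point_vec A a) = real_of_int c * real (card (carrier A)) * v $ a"
proof -
  let ?n = "real (card (carrier A))"
  have 0: "v $ x = 0" if "x \<notin> carrier A" for x using assms(1) that by (simp add: aug_space_def)
  have "(\<Sum>x\<in>UNIV. v $ x) = (\<Sum>x\<in>carrier A. v $ x)"
    using 0 by (intro sum.mono_neutral_right) auto
  hence sum: "(\<Sum>x\<in>UNIV. v $ x) = 0" using assms(1) by (simp add: aug_space_def)
  have "v \<bullet> real_coeffs (c *s point_vec A a) = (\<Sum>x\<in>UNIV. (if x = a then c * ?n * v $ x else 0) - c * v $ x)"
    unfolding inner_vec_def using assms(2) 0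
    by (intro sum.cong) (auto simp: point_vec_def algebra_simps)
  also have "\<dots> = c * ?n * v $ a"
    by (simp add: sum_subtractf sum_distrib_left[symmetric] sum)
  finally show ?thesis .
qed

text \<open>The projections of an orthonormal basis onto a subspace form a tight frame there, and up
  to scaling the point vectors are such projections.\<close>

lemma sum_point_vec:
  fixes c :: int
  assumes v: "v \<in> aug_space A"
  shows "(\<Sum>a\<in>carrier A. proj_along (real_coeffs (c *s point_vec A a)) v) = (real_of_int c * real (card (carrier A)))\<^sup>2 *\<^sub>R v"
proof (rule vec_eq_iff[THEN iffD2, rule_format])
  fix y
  let ?n = "real (card (carrier A))"
  have "(\<Sum>a\<in>carrier A. proj_along (real_coeffs (c *s point_vec A a)) v) $ y
      = (\<Sum>a\<in>carrier A. c * ?n * v $ a * (c * ((if a = y then ?n else 0) - (if y \<in> carrier A then 1 else 0))))"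
    by (simp add: proj_along_def inner_point_vec[OF v])
      (auto simp: point_vec_def intro!: sum.cong)
  also have "\<dots> = (\<Sum>a\<in>carrier A. (if a = y then (c * ?n)\<^sup>2 * v $ a else 0)
      - c\<^sup>2 * ?n * (if y \<in> carrier A then 1 else 0) * v $ a)"
    by (intro sum.cong) (auto simp: power2_eq_square algebra_simps)
  also have "\<dots> = (c * ?n)\<^sup>2 * v $ y"
    using v by (auto simp: sum_subtractf sum_distrib_left[symmetric] aug_space_def)
  finally show "(\<Sum>a\<in>carrier A. proj_along (real_coeffs (c *s point_vec A a)) v) $ y
      = ((c * ?n)\<^sup>2 *\<^sub>R v) $ y" by simp
qed

text \<open>The assumptions \<open>rel\<close>, \<open>min\<close> and \<open>eq\<close> identify
  the minimal vectors. A vector and its negative have the same projection, so unit weights give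
  twice the constant of \<open>sum_point_vec\<close>.\<close>

lemma eutactic_small:
  fixes A :: "('a::finite, 'm) monoid_scheme" and c :: int
  defines "m \<equiv> c\<^sup>2 * (int (card (carrier A)) * (int (card (carrier A)) - 1))"
  assumes A: "comm_group A" and n: "card (carrier A) \<ge> 2" and c: "c > 0"
    and rel: "\<And>a. a \<in> carrier A \<Longrightarrow> c *s point_vec A a \<in> relations A"
    and min: "\<And>k. k \<in> relations A \<Longrightarrow> k \<noteq> 0 \<Longrightarrow> int_norm_sq k \<ge> m"
    and eq: "\<And>k. k \<in> relations A \<Longrightarrow> int_norm_sq k = m \<Longrightarrow>
      \<exists>a\<in>carrier A. k = c *s point_vec A a \<or> k = - (c *s point_vec A a)"
  shows "eutactic_lattice_in (span (group_lattice A)) (group_lattice A)"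
proof -
  interpret comm_group A by (rule A)
  \<comment> \<open>At order two the point vectors of the two elements are opposite, so
    \<open>s\<close> is not injective; \<open>eutactic_inI\<close> allows for that.\<close>
  define s where "s = (\<lambda>(a, \<sigma> :: real). \<sigma> *\<^sub>R real_coeffs (c *s point_vec A a))"
  have "m > 0" using n c by (simp add: m_def)
  have norm: "int_norm_sq (c *s point_vec A a) = m" if "a \<in> carrier A" for a
    using int_norm_sq_point_vec[OF that] by (simp add: m_def)
  have neg: "int_norm_sq (- k) = int_norm_sq k" "real_coeffs (- k) = - real_coeffs k" for k :: "int ^ 'a"
    by (simp_all add: int_norm_sq_def vec_eq_iff)
  have "min_vecs (group_lattice A) = real_coeffs ` {k \<in> relations A. int_norm_sq k = m}"
    by (rule min_vecs_group_lattice[OF \<open>m > 0\<close> rel norm min]) auto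
  also have "\<dots> = s ` (carrier A \<times> {1, - 1})"
  proof (intro equalityI subsetI)
    fix y assume "y \<in> real_coeffs ` {k \<in> relations A. int_norm_sq k = m}"
    then obtain k where y: "y = real_coeffs k" and "k \<in> relations A" "int_norm_sq k = m" by blast
    from eq[OF this(2,3)] obtain a where a: "a \<in> carrier A"
      "k = c *s point_vec A a \<or> k = - (c *s point_vec A a)" by blast
    from a(2) show "y \<in> s ` (carrier A \<times> {1, - 1})"
    proof
      assume "k = c *s point_vec A a"
      hence "y = s (a, 1)" by (simp add: s_def y)
      thus ?thesis using a(1) by blast
    next
      assume "k = - (c *s point_vec A a)"
      hence "y = s (a, - 1)" by (simp only: s_def y neg prod.case scaleR_minus1_left)
      thus ?thesis using a(1) by blast
    qed
  next
    fix y assume "y \<in> s ` (carrier A \<times> {1, - 1})"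
    then obtain a where a: "a \<in> carrier A" and "y = s (a, 1) \<or> y = s (a, - 1)" by blast
    hence "y = real_coeffs (c *s point_vec A a) \<or> y = real_coeffs (- (c *s point_vec A a))"
      by (simp only: s_def neg prod.case scaleR_minus1_left scaleR_one)
    thus "y \<in> real_coeffs ` {k \<in> relations A. int_norm_sq k = m}"
    proof
      assume "y = real_coeffs (c *s point_vec A a)"
      with rel[OF a] norm[OF a] show ?thesis by blast
    next
      assume "y = real_coeffs (- (c *s point_vec A a))"
      moreover have "- (c *s point_vec A a) \<in> relations A"
        by (rule relations_minus[OF A rel[OF a]])
      moreover have "int_norm_sq (- (c *s point_vec A a)) = m" unfolding neg by (rule norm[OF a])
      ultimately show ?thesis by blast
    qed
  qed
  finally have mv: "min_vecs (group_lattice A) = s ` (carrier A \<times> {1, - 1})" .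
  show ?thesis
    unfolding eutactic_lattice_in_def
  proof (rule eutactic_inI[OF _ _ mv, where r = "\<lambda>_. 1" and l = "2 * (real_of_int c * real (card (carrier A)))\<^sup>2"])
    show "min_vecs (group_lattice A) \<subseteq> span (group_lattice A)"
      using \<open>min_vecs (group_lattice A) = real_coeffs ` _\<close>
      by (auto simp: group_lattice_eq intro!: span_base)
    fix v assume "v \<in> span (group_lattice A)"
    hence v: "v \<in> aug_space A" using span_group_lattice by blast
    have "(\<Sum>q\<in>carrier A \<times> {1, - 1}. 1 *\<^sub>R proj_along (s q) v)
        = (\<Sum>a\<in>carrier A. proj_along (s (a, 1)) v + proj_along (s (a, - 1)) v)"
      unfolding sum.cartesian_product' by simp
    also have "\<dots> = (\<Sum>a\<in>carrier A. 2 *\<^sub>R proj_along (real_coeffs (c *s point_vec A a)) v)"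
      by (simp only: s_def prod.case scaleR_one scaleR_minus1_left proj_along_def inner_minus_right
          scaleR_minus_left scaleR_minus_right minus_minus scaleR_2)
    also have "\<dots> = (2 * (real_of_int c * real (card (carrier A)))\<^sup>2) *\<^sub>R v"
      by (simp only: scaleR_right.sum[symmetric] sum_point_vec[OF v] scaleR_scaleR)
    finally show "(\<Sum>q\<in>carrier A \<times> {1, - 1}. 1 *\<^sub>R proj_along (s q) v)
        = (2 * (real_of_int c * real (card (carrier A)))\<^sup>2) *\<^sub>R v" .
  qed (use n c in auto)
qed

lemma int_norm_sq_carrier:
  "k \<in> relations A \<Longrightarrow> int_norm_sq k = (\<Sum>x\<in>carrier A. (k $ x)\<^sup>2)"
  unfolding int_norm_sq_def by (intro sum.mono_neutral_right) (auto simp: relationsD)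

text \<open>A nonzero relation of squared norm at most 4 comes from a proper quad, which has four
  distinct entries.\<close>

lemma int_norm_sq_small:
  fixes A :: "('a::finite, 'm) monoid_scheme"
  assumes A: "comm_group A" and n: "card (carrier A) < 4" and k: "k \<in> relations A" "k \<noteq> 0"
  shows "int_norm_sq k \<ge> 5"
proof (rule ccontr)
  assume "\<not> ?thesis"
  then obtain q where q: "q \<in> proper_quads A" using short_relations[OF A k] by auto
  obtain a b c d where abcd: "q = (a, b, c, d)" by (cases q)
  have "distinct [a, b, c, d]" using proper_quads_distinct[OF A] q by (simp add: abcd)
  moreover have "set [a, b, c, d] \<subseteq> carrier A" using q by (simp add: abcd proper_quads_def quads_def)
  ultimately have "4 \<le> card (carrier A)" using card_mono[of "carrier A" "set [a, b, c, d]"]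
    by (simp only: distinct_card finite) simp
  with n show False by simp
qed

text \<open>A sum-zero vector is \<open>m\<close> times the difference of the two elements and has
  squared norm \<open>2 * m^2\<close>. The lower bound 5 forces \<open>m\<close> to be at least 2 in
  absolute value, and 2 is attained because every square in the group is one.\<close>

lemma eutactic_order_2:
  fixes A :: "('a::finite, 'm) monoid_scheme"
  assumes A: "comm_group A" and n: "card (carrier A) = 2"
  shows "eutactic_lattice_in (span (group_lattice A)) (group_lattice A)"
proof -
  interpret comm_group A by (rule A)
  have other: "\<exists>b. carrier A = {a, b} \<and> a \<noteq> b" if "a \<in> carrier A" for a
    using n that unfolding card_2_iff by auto
  have form: "int_norm_sq k = 2 * (k $ a)\<^sup>2" "k $ b = - k $ a"
    if "k \<in> relations A" "carrier A = {a, b}" "a \<noteq> b" for k a b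
  proof -
    show "k $ b = - k $ a" using relationsD(2)[OF that(1)] that(2,3) by simp
    thus "int_norm_sq k = 2 * (k $ a)\<^sup>2"
      using int_norm_sq_carrier[OF that(1)] that(2,3) by simp
  qed
  have ge: "\<bar>k $ a\<bar> \<ge> 2" if "k \<in> relations A" "k \<noteq> 0" "carrier A = {a, b}" "a \<noteq> b" for k a b
  proof (rule ccontr)
    assume "\<not> ?thesis"
    hence "k $ a = - 1 \<or> k $ a = 0 \<or> k $ a = 1" by arith
    hence "(k $ a)\<^sup>2 \<le> 1" by auto
    thus False using int_norm_sq_small[OF A _ that(1,2)] n form(1)[OF that(1,3,4)] by simp
  qed
  obtain a where "a \<in> carrier A" by blast
  with other obtain b where ab: "carrier A = {a, b}" "a \<noteq> b" by blast
  show ?thesis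
  proof (rule eutactic_small[OF A, of 2])
    fix x assume x: "x \<in> carrier A"
    with other obtain y where y: "carrier A = {x, y}" "x \<noteq> y" by blast
    have pv: "point_vec A x = axis x 1 - axis y 1"
      using y n by (auto simp: vec_eq_iff point_vec_def axis_def)
    define p where "p = psi A (point_vec A x)"
    have "p \<in> carrier A" by (simp add: p_def psi_closed[OF A])
    show "2 *s point_vec A x \<in> relations A"
    proof (rule relationsI)
      have "2 *s point_vec A x = point_vec A x + point_vec A x"
        by (simp add: vec_eq_iff)
      hence "psi A (2 *s point_vec A x) = p \<otimes>\<^bsub>A\<^esub> p" by (simp only: psi_add[OF A] p_def)
      also have "\<dots> = p [^]\<^bsub>A\<^esub> order A"
        using \<open>p \<in> carrier A\<close> n by (simp add: order_def numeral_2_eq_2)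
      also have "\<dots> = \<one>\<^bsub>A\<^esub>" using \<open>p \<in> carrier A\<close> by (rule pow_order_eq_1)
      finally show "psi A (2 *s point_vec A x) = \<one>\<^bsub>A\<^esub>" .
    qed (use y in \<open>auto simp: pv axis_def\<close>)
  next
    fix k assume k: "k \<in> relations A" "k \<noteq> 0"
    have "2\<^sup>2 \<le> (k $ a)\<^sup>2" using ge[OF k ab] abs_le_square_iff[of 2 "k $ a"] by simp
    thus "2\<^sup>2 * (int (card (carrier A)) * (int (card (carrier A)) - 1)) \<le> int_norm_sq k"
      using n form(1)[OF k(1) ab] by simp
  next
    fix k assume k: "k \<in> relations A"
      and "int_norm_sq k = 2\<^sup>2 * (int (card (carrier A)) * (int (card (carrier A)) - 1))"
    hence "(k $ a)\<^sup>2 = 2\<^sup>2" using n form(1)[OF k ab] by simp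
    hence "k $ a = 2 \<or> k $ a = - 2" by (simp only: power2_eq_iff)
    hence "k = 2 *s point_vec A a \<or> k = - (2 *s point_vec A a)"
      using ab n form(2)[OF k ab] relationsD(1)[OF k] by (auto simp: vec_eq_iff point_vec_def)
    thus "\<exists>a\<in>carrier A. k = 2 *s point_vec A a \<or> k = - (2 *s point_vec A a)"
      using ab by blast
  qed (use n in auto)
qed

text \<open>Eliminating \<open>r\<close> shows that the sum of squares is even, so 5 improves to 6.
  At 6 all entries lie between -2 and 2, which leaves finitely many cases.\<close>

lemma sum_zero_squares_three:
  fixes p q r :: int
  assumes "p + q + r = 0" "p\<^sup>2 + q\<^sup>2 + r\<^sup>2 \<ge> 5"
  shows "p\<^sup>2 + q\<^sup>2 + r\<^sup>2 \<ge> 6"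
    and "p\<^sup>2 + q\<^sup>2 + r\<^sup>2 = 6 \<Longrightarrow> (p, q, r) \<in> {(2, -1, -1), (-1, 2, -1), (-1, -1, 2), (-2, 1, 1), (1, -2, 1), (1, 1, -2)}"
proof -
  have r: "r = - p - q" using assms(1) by simp
  have eq: "p\<^sup>2 + q\<^sup>2 + r\<^sup>2 = 2 * (p\<^sup>2 + p * q + q\<^sup>2)"
    by (simp add: r power2_eq_square algebra_simps)
  show "p\<^sup>2 + q\<^sup>2 + r\<^sup>2 \<ge> 6" using assms(2) unfolding eq by presburger
  assume six: "p\<^sup>2 + q\<^sup>2 + r\<^sup>2 = 6"
  have bound: "x = -2 \<or> x = -1 \<or> x = 0 \<or> x = 1 \<or> x = 2" if "x\<^sup>2 \<le> 6" for x :: int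
  proof -
    have "\<bar>x\<bar> < 3" by (rule power2_less_imp_less) (use that in auto)
    thus ?thesis by arith
  qed
  have "p\<^sup>2 \<le> 6" "q\<^sup>2 \<le> 6" using six zero_le_power2[of p] zero_le_power2[of q] zero_le_power2[of r] by linarith+
  from bound[OF this(1)] bound[OF this(2)] six
  show "(p, q, r) \<in> {(2, -1, -1), (-1, 2, -1), (-1, -1, 2), (-2, 1, 1), (1, -2, 1), (1, 1, -2)}"
    unfolding r by (elim disjE) simp_all
qed

text \<open>The quotient of \<open>b c\<close> by \<open>a\<close> is one of the three elements. If
  it were \<open>b\<close> or \<open>c\<close>, cancellation would identify \<open>a\<close> with
  the other of the two.\<close>

lemma (in comm_group) card_3_square:
  assumes "carrier G = {a, b, c}" "distinct [a, b, c]"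
  shows "a \<otimes> a = b \<otimes> c"
proof -
  have carr: "a \<in> carrier G" "b \<in> carrier G" "c \<in> carrier G" using assms(1) by auto
  define y where "y = b \<otimes> c \<otimes> inv a"
  have "y \<in> carrier G" and ya: "y \<otimes> a = b \<otimes> c"
    using carr by (simp_all add: y_def m_assoc)
  from this(1) consider "y = a" | "y = b" | "y = c" unfolding assms(1) by blast
  thus ?thesis
  proof cases
    case 2
    hence "c = a"
      using ya carr m_comm[of b a] m_comm[of b c] right_cancel[of c b a] by simp
    thus ?thesis using assms(2) by simp
  next
    case 3
    hence "a = b"
      using ya carr m_comm[of c a] right_cancel[of a c b] by simp
    thus ?thesis using assms(2) by simp
  qed (use ya in simp)
qed

text \<open>By parity the smallest possible squared norm is 6, and it leaves only the point vectors
  \<open>2 a - b - c\<close> and their negatives. They are relations as vectors of the quads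
  \<open>(a, a, b, c)\<close>, which are not proper.\<close>

lemma eutactic_order_3:
  fixes A :: "('a::finite, 'm) monoid_scheme"
  assumes A: "comm_group A" and n: "card (carrier A) = 3"
  shows "eutactic_lattice_in (span (group_lattice A)) (group_lattice A)"
proof -
  interpret comm_group A by (rule A)
  obtain x y z where xyz: "carrier A = {x, y, z}" "distinct [x, y, z]"
    using n unfolding card_3_iff by auto
  have other: "\<exists>b c. carrier A = {a, b, c} \<and> distinct [a, b, c]" if a: "a \<in> carrier A" for a
  proof -
    from a consider "a = x" | "a = y" | "a = z" unfolding xyz by blast
    thus ?thesis
    proof cases
      case 1 thus ?thesis using xyz by blast
    next
      case 2 thus ?thesis using xyz by (intro exI[of _ x] exI[of _ z]) auto
    next
      case 3 thus ?thesis using xyz by (intro exI[of _ x] exI[of _ y]) auto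
    qed
  qed
  have form: "int_norm_sq k = (k $ x)\<^sup>2 + (k $ y)\<^sup>2 + (k $ z)\<^sup>2" "k $ x + k $ y + k $ z = 0"
    if "k \<in> relations A" for k
    using relationsD(2)[OF that] int_norm_sq_carrier[OF that] xyz by simp_all
  show ?thesis
  proof (rule eutactic_small[OF A, of 1])
    fix a assume "a \<in> carrier A"
    with other obtain b c where abc: "carrier A = {a, b, c}" "distinct [a, b, c]" by blast
    have "1 *s point_vec A a = quad_vec (a, a, b, c)"
      using abc n by (auto simp: vec_eq_iff point_vec_def quad_vec_def axis_def)
    moreover have "(a, a, b, c) \<in> quads A"
      using abc card_3_square[OF abc] by (auto simp: quads_def)
    ultimately show "1 *s point_vec A a \<in> relations A"
      using quad_vec_in_relations[OF A] by metis
  next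
    fix k assume k: "k \<in> relations A" "k \<noteq> 0"
    have "5 \<le> (k $ x)\<^sup>2 + (k $ y)\<^sup>2 + (k $ z)\<^sup>2"
      using int_norm_sq_small[OF A _ k] n form(1)[OF k(1)] by simp
    from sum_zero_squares_three(1)[OF form(2)[OF k(1)] this]
    show "1\<^sup>2 * (int (card (carrier A)) * (int (card (carrier A)) - 1)) \<le> int_norm_sq k"
      using n form(1)[OF k(1)] by simp
  next
    fix k assume k: "k \<in> relations A"
      and "int_norm_sq k = 1\<^sup>2 * (int (card (carrier A)) * (int (card (carrier A)) - 1))"
    hence "(k $ x)\<^sup>2 + (k $ y)\<^sup>2 + (k $ z)\<^sup>2 = 6" using n form(1)[OF k] by simp
    hence cases: "(k $ x, k $ y, k $ z) \<in> {(2, -1, -1), (-1, 2, -1), (-1, -1, 2), (-2, 1, 1), (1, -2, 1), (1, 1, -2)}"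
      using sum_zero_squares_three(2)[OF form(2)[OF k]] by simp
    have eqI: "k = l" if "k $ x = l $ x" "k $ y = l $ y" "k $ z = l $ z" "\<And>w. w \<notin> carrier A \<Longrightarrow> l $ w = 0"
      for l
      using that relationsD(1)[OF k] by (metis empty_iff insert_iff vec_eq_iff xyz(1))
    have pv: "(1 *s point_vec A a) $ w = (if w = a then 2 else if w \<in> carrier A then - 1 else 0)" for a w
      using n by (simp add: point_vec_def)
    have dist: "x \<noteq> y" "x \<noteq> z" "y \<noteq> z" "y \<noteq> x" "z \<noteq> x" "z \<noteq> y" using xyz by auto
    have mem: "x \<in> carrier A" "y \<in> carrier A" "z \<in> carrier A" using xyz by auto
    have out: "w \<noteq> a" if "a \<in> carrier A" "w \<notin> carrier A" for a w using that by blast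
    note simps = pv vector_uminus_component dist mem out if_True if_False simp_thms minus_minus minus_zero
    let ?P = "\<lambda>a. k = 1 *s point_vec A a \<or> k = - (1 *s point_vec A a)"
    from cases consider "k $ x = 2" "k $ y = -1" "k $ z = -1" | "k $ x = -1" "k $ y = 2" "k $ z = -1"
      | "k $ x = -1" "k $ y = -1" "k $ z = 2" | "k $ x = -2" "k $ y = 1" "k $ z = 1"
      | "k $ x = 1" "k $ y = -2" "k $ z = 1" | "k $ x = 1" "k $ y = 1" "k $ z = -2" by auto
    hence "?P x \<or> ?P y \<or> ?P z"
    proof cases
      case 1
      have "k = 1 *s point_vec A x" by (rule eqI) (simp_all only: simps 1)
      thus ?thesis by blast
    next
      case 2
      have "k = 1 *s point_vec A y" by (rule eqI) (simp_all only: simps 2)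
      thus ?thesis by blast
    next
      case 3
      have "k = 1 *s point_vec A z" by (rule eqI) (simp_all only: simps 3)
      thus ?thesis by blast
    next
      case 4
      have "k = - (1 *s point_vec A x)" by (rule eqI) (simp_all only: simps 4)
      thus ?thesis by blast
    next
      case 5
      have "k = - (1 *s point_vec A y)" by (rule eqI) (simp_all only: simps 5)
      thus ?thesis by blast
    next
      case 6
      have "k = - (1 *s point_vec A z)" by (rule eqI) (simp_all only: simps 6)
      thus ?thesis by blast
    qed
    thus "\<exists>a\<in>carrier A. ?P a" using mem by blast
  qed (use n in auto)
qed

section \<open>The trivial group, order four and the case distinction\<close>

lemma eutactic_order_1:
  fixes A :: "('a::finite, 'm) monoid_scheme"
  assumes A: "comm_group A" and n: "card (carrier A) = 1"
  shows "eutactic_lattice_in (span (group_lattice A)) (group_lattice A)"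
proof -
  interpret comm_group A by (rule A)
  have "k = 0" if k: "k \<in> relations A" for k
  proof -
    obtain a where a: "carrier A = {a}" using n by (auto simp: card_1_singleton_iff)
    hence "k $ a = 0" using relationsD(2)[OF k] by simp
    moreover have "k $ x = 0" if "x \<noteq> a" for x using relationsD(1)[OF k] a that by simp
    ultimately show ?thesis by (metis vec_eq_iff zero_index)
  qed
  moreover have "(0 :: int ^ 'a) \<in> relations A"
    by (rule relationsI) (auto simp: psi_def)
  ultimately have "relations A = {0}" by blast
  hence "group_lattice A = {0}" by (simp add: group_lattice_eq)
  \<comment> \<open>The span is zero and \<open>min_vecs\<close> is empty by convention, so the
    empty sum is the identity there.\<close>
  thus ?thesis by (simp add: eutactic_lattice_in_def eutactic_in_def min_vecs_def)
qed

lemma order_4_cyclic: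
  fixes A :: "('a, 'm) monoid_scheme"
  assumes A: "comm_group A" and n: "card (carrier A) = 4"
    and x: "x \<in> carrier A" "x \<otimes>\<^bsub>A\<^esub> x \<noteq> \<one>\<^bsub>A\<^esub>"
  shows "A \<cong> integer_mod_group 4"
proof -
  interpret comm_group A by (rule A)
  have fin: "finite (carrier A)" using n by (simp add: card_ge_0_finite)
  have "ord x dvd 4" using ord_dvd_group_order[OF x(1)] n by (simp add: order_def)
  hence "ord x \<le> 4" by (rule dvd_imp_le) simp
  \<comment> \<open>The order divides 4 but not 2, since the square of \<open>x\<close> is not one;
    only 4 is left.\<close>
  have "\<not> ord x dvd 2"
    using pow_eq_id[OF x(1), of 2] x by (simp add: numeral_2_eq_2)
  hence "ord x \<noteq> 1" "ord x \<noteq> 2" "ord x \<noteq> 3" using \<open>ord x dvd 4\<close> by auto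
  moreover have "ord x \<noteq> 0" using \<open>ord x dvd 4\<close> by (intro notI) simp
  ultimately have ord: "ord x = 4" using \<open>ord x \<le> 4\<close> by linarith
  let ?Z = "integer_mod_group 4" and ?h = "\<lambda>i::int. x [^]\<^bsub>A\<^esub> i"
  have pow: "?h i = ?h j \<longleftrightarrow> 4 dvd j - i" for i j
    using int_pow_eq[OF x(1), of i j] ord by simp
  have inj: "inj_on ?h (carrier ?Z)"
  proof (rule inj_onI)
    fix i j assume "i \<in> carrier ?Z" "j \<in> carrier ?Z" "?h i = ?h j"
    thus "i = j" unfolding pow carrier_integer_mod_group by auto presburger
  qed
  have "?h ` carrier ?Z = carrier A"
  proof (rule card_subset_eq[OF fin])
    show "card (?h ` carrier ?Z) = card (carrier A)"
      unfolding card_image[OF inj] by (simp add: n carrier_integer_mod_group)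
  qed (use x in auto)
  with inj have "bij_betw ?h (carrier ?Z) (carrier A)" by (simp add: bij_betw_def)
  moreover have "?h \<in> hom ?Z A"
  proof (rule homI)
    fix i j :: int
    \<comment> \<open>The operation of \<open>integer_mod_group 4\<close> reduces modulo 4, which
      does not change the power of \<open>x\<close>.\<close>
    have "4 dvd (i + j) - (i + j) mod 4" by presburger
    thus "?h (i \<otimes>\<^bsub>?Z\<^esub> j) = ?h i \<otimes>\<^bsub>A\<^esub> ?h j"
      using x by (simp add: int_pow_mult[symmetric] pow)
  qed (use x in simp)
  ultimately have "?Z \<cong> A" by (intro is_isoI isoI)
  thus ?thesis by (rule group.iso_sym[OF group_integer_mod_group])
qed

theorem theorem5p10:
  fixes A :: "('a::finite, 'm) monoid_scheme"
  assumes "comm_group A"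
    and "\<not> A \<cong> integer_mod_group 4"
  shows "eutactic_lattice_in (span (group_lattice A)) (group_lattice A)"
proof -
  interpret comm_group A by fact
  have "card (carrier A) > 0" by (auto simp: card_gt_0_iff)
  then consider "card (carrier A) = 1" | "card (carrier A) = 2" | "card (carrier A) = 3"
    | "card (carrier A) = 4" | "card (carrier A) \<ge> 5" by linarith
  thus ?thesis
  proof cases
    \<comment> \<open>By \<open>order_4_cyclic\<close> a group of order four that is not cyclic has
      only trivial squares, which is the first alternative of \<open>eutactic_large\<close>.\<close>
    case 4
    thus ?thesis using eutactic_large[OF assms(1)] order_4_cyclic[OF assms(1)] assms(2) by fastforce
  next
    case 5
    thus ?thesis using eutactic_large[OF assms(1)] by simp
  qed (rule eutactic_order_1 eutactic_order_2 eutactic_order_3, rule assms, assumption)+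
qed

end
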